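(* Let $(e^{tA})_{t \ge 0}$ be a real $C_0$-semigroup with generator $A$ on a complex Banach lattice $E$ and let $u \in E_+$ be a quasi-interior point of $E_+$. Assume that the spectral bound $\mathrm{s}(A)$ is not equal to $-\infty$ and is a pole of the resolvent $\mathcal{R}(\,\cdot\,,A)$. If $(e^{tA})_{t \ge 0}$ is individually eventually strongly positive with respect to $u$, then the spectral projection $P$ corresponding to $\mathrm{s}(A)$ fulfils $P \gg_u 0$.
   Context: $E_+$ is the positive cone of $E$ and $E_{\mathbb{R}}$ the real part of $E$. For $u \in E_+$ the principal ideal generated by $u$ is $E_u := \{f \in E : \exists c \ge 0,\ |f| \le cu\}$; $u$ is a quasi-interior point of $E_+$ if $E_u$ is dense in $E$. We write $f > 0$ if $f \ge 0$ and $f \ne 0$. For $f \in E_+$ we write $f \gg_u 0$ if there exists $\varepsilon > 0$ such that $f \ge \varepsilon u$. A bounded linear operator $T$ on $E$ is strongly positive with respect to $u$, written $T \gg_u 0$, if $Tf \gg_u 0$ for every $0 < f \in E$. The semigroup is real if $e^{tA}E_{\mathbb{R}} \subseteq E_{\mathbb{R}}$ for every $t \ge 0$. The semigroup $(e^{tA})_{t\ge 0}$ is individually eventually strongly positive with respect to $u$ if, for every $0 < f \in E$, there exists $t_0 \ge 0$ such that $e^{tA}f \gg_u 0$ for all $t \ge t_0$. The spectral bound is $\mathrm{s}(A) := \sup\{\operatorname{Re}\lambda : \lambda \in \sigma(A)\} \in [-\infty,\infty]$. For $\lambda$ in the resolvent set $\rho(A)$, $\mathcal{R}(\lambda,A)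 := (\lambda I - A)^{-1}$, an analytic map on $\rho(A)$. *)

theory Defs
  imports "HOL-Analysis.Analysis" "HOL-Library.Lattice_Algebras"
begin

section \<open>Real Banach lattices\<close>

class banach_lattice = banach + ordered_real_vector + lattice_ab_group_add_abs +
  assumes norm_mono_abs: "\<bar>x\<bar> \<le> \<bar>y\<bar> \<Longrightarrow> norm x \<le> norm y"

instance real :: banach_lattice
  by standard simp

lemma norm_mono_pos:
  fixes x y :: "'a::banach_lattice"
  assumes "0 \<le> x" "x \<le> y"
  shows "norm x \<le> norm y"
proof -
  have "\<bar>x\<bar> = x" "\<bar>y\<bar> = y" using assms by (auto simp: abs_of_nonneg)
  thus ?thesis using norm_mono_abs[of x y] assms by simp
qed

lemma norm_abs_banach_lattice [simp]:
  fixes x :: "'a::banach_lattice"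
  shows "norm \<bar>x\<bar> = norm x"
  by (intro antisym norm_mono_abs) auto

lemma abs_scaleR_le_banach_lattice:
  fixes x :: "'a::banach_lattice"
  assumes "\<bar>r\<bar> \<le> s"
  shows "r *\<^sub>R x \<le> s *\<^sub>R \<bar>x\<bar>"
proof -
  have "r *\<^sub>R x \<le> \<bar>r\<bar> *\<^sub>R \<bar>x\<bar>"
  proof (cases "r \<ge> 0")
    case True
    thus ?thesis by (simp add: scaleR_left_mono abs_ge_self)
  next
    case False
    hence "(-r) *\<^sub>R (-x) \<le> (-r) *\<^sub>R \<bar>x\<bar>"
      by (intro scaleR_left_mono abs_ge_minus_self) auto
    thus ?thesis using False by simp
  qed
  also have "\<dots> \<le> s *\<^sub>R \<bar>x\<bar>" using assms by (intro scaleR_right_mono) auto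
  finally show ?thesis .
qed

lemma banach_lattice_limit_nonneg:
  fixes X :: "nat \<Rightarrow> 'a::banach_lattice"
  assumes "\<And>n. 0 \<le> X n" "X \<longlonglongrightarrow> L"
  shows "0 \<le> L"
proof -
  have le: "norm (pprt (- L)) \<le> norm (X n - L)" for n
  proof -
    have "- L \<le> X n - L" using assms(1)[of n] by simp
    also have "\<dots> \<le> \<bar>X n - L\<bar>" by (rule abs_ge_self)
    finally have "pprt (- L) \<le> \<bar>X n - L\<bar>" by (simp add: pprt_def)
    hence "norm (pprt (- L)) \<le> norm \<bar>X n - L\<bar>" by (intro norm_mono_pos) auto
    thus ?thesis by simp
  qed
  have "(\<lambda>n. norm (X n - L)) \<longlonglongrightarrow> 0"
    using assms(2) by (simp add: LIM_zero_iff tendsto_norm_zero)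
  hence "norm (pprt (- L)) \<le> 0"
    by (rule LIMSEQ_le_const) (use le in auto)
  hence "pprt (- L) = 0" by simp
  thus ?thesis by (metis le_zero_iff_zero_pprt neg_le_0_iff_le)
qed

lemma banach_lattice_limit_mono:
  fixes X Y :: "nat \<Rightarrow> 'a::banach_lattice"
  assumes "\<And>n. X n \<le> Y n" "X \<longlonglongrightarrow> K" "Y \<longlonglongrightarrow> L"
  shows "K \<le> L"
  using banach_lattice_limit_nonneg[of "\<lambda>n. Y n - X n" "L - K"] assms
  by (auto intro: tendsto_diff)


section \<open>Complex Banach spaces\<close>

class scaleC =
  fixes scaleC :: "complex \<Rightarrow> 'a \<Rightarrow> 'a"  (infixr \<open>*\<^sub>C\<close> 75)

class complex_banach = banach + scaleC +
  assumes scaleC_add_right: "c *\<^sub>C (x + y) = c *\<^sub>C x + c *\<^sub>C y"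
    and scaleC_add_left: "(c + d) *\<^sub>C x = c *\<^sub>C x + d *\<^sub>C x"
    and scaleC_scaleC: "c *\<^sub>C d *\<^sub>C x = (c * d) *\<^sub>C x"
    and scaleC_of_real: "complex_of_real r *\<^sub>C x = r *\<^sub>R x"
    and norm_scaleC: "norm (c *\<^sub>C x) = cmod c * norm x"

lemma bounded_linear_scaleC:
  "bounded_linear ((*\<^sub>C) c :: 'a::complex_banach \<Rightarrow> 'a)"
proof (rule bounded_linear_intro)
  fix r :: real and x y :: 'a
  show "c *\<^sub>C (x + y) = c *\<^sub>C x + c *\<^sub>C y" by (rule scaleC_add_right)
  show "c *\<^sub>C (r *\<^sub>R x) = r *\<^sub>R (c *\<^sub>C x)"
    by (simp add: scaleC_of_real[symmetric] scaleC_scaleC mult.commute)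
  show "norm (c *\<^sub>C x) \<le> norm x * cmod c" by (simp add: norm_scaleC)
qed

text \<open>
  The type \<open>'a \<Rightarrow>\<^sub>L 'b\<close> consists of the bounded real-linear maps.  For a complex Banach space \<open>'b\<close>
  it is a complex Banach space, in which the bounded complex-linear maps form a closed subspace.
\<close>

instantiation blinfun :: (real_normed_vector, complex_banach) complex_banach
begin

lift_definition scaleC_blinfun :: "complex \<Rightarrow> ('a \<Rightarrow>\<^sub>L 'b) \<Rightarrow> 'a \<Rightarrow>\<^sub>L 'b"
  is "\<lambda>c S x. c *\<^sub>C S x"
  by (rule bounded_linear_compose[OF bounded_linear_scaleC])

instance
proof
  fix c d :: complex and r :: real and S U :: "'a \<Rightarrow>\<^sub>L 'b"
  show "c *\<^sub>C (S + U) = c *\<^sub>C S + c *\<^sub>C U"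
    by transfer (simp add: scaleC_add_right)
  show "(c + d) *\<^sub>C S = c *\<^sub>C S + d *\<^sub>C S"
    by transfer (simp add: scaleC_add_left)
  show "c *\<^sub>C d *\<^sub>C S = (c * d) *\<^sub>C S"
    by transfer (simp add: scaleC_scaleC)
  show "complex_of_real r *\<^sub>C S = r *\<^sub>R S"
    by transfer (simp add: scaleC_of_real)
  have 1: "norm (c *\<^sub>C S) \<le> cmod c * norm S" for c and S :: "'a \<Rightarrow>\<^sub>L 'b"
  proof (rule norm_blinfun_bound)
    fix x show "norm (blinfun_apply (c *\<^sub>C S) x) \<le> cmod c * norm S * norm x"
      by (simp add: scaleC_blinfun.rep_eq norm_scaleC mult.assoc mult_left_mono norm_blinfun)
  qed simp
  show "norm (c *\<^sub>C S) = cmod c * norm S"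
  proof (cases "c = 0")
    case True
    thus ?thesis using 1[of c S] by simp
  next
    case False
    have "S = inverse c *\<^sub>C c *\<^sub>C S"
    proof (rule blinfun_eqI)
      fix x
      show "S x = (inverse c *\<^sub>C c *\<^sub>C S) x"
        using False scaleC_of_real[of 1 "S x"] by (simp add: scaleC_blinfun.rep_eq scaleC_scaleC)
    qed
    hence "norm S \<le> inverse (cmod c) * norm (c *\<^sub>C S)"
      using 1[of "inverse c" "c *\<^sub>C S"] by (simp add: norm_inverse)
    hence "cmod c * norm S \<le> norm (c *\<^sub>C S)"
      using False by (simp add: field_simps)
    with 1[of c S] show ?thesis by simp
  qed
qed

end


section \<open>Complex Banach lattices\<close>

text \<open>
  A complex Banach lattice is the complexification \<open>E = E\<^sub>\<real> \<oplus> i E\<^sub>\<real>\<close> of a real Banach lattice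
  \<open>E\<^sub>\<real>\<close>, with modulus \<open>|z| = sup {cos \<theta> x + sin \<theta> y | \<theta>}\<close> for \<open>z = x + i y\<close> and norm
  \<open>\<parallel>z\<parallel> = \<parallel>|z|\<parallel>\<close>.
\<close>

datatype 'a complexification = Complexify (re_part: 'a) (im_part: 'a)

lemma complexification_eq_iff:
  "z = w \<longleftrightarrow> re_part z = re_part w \<and> im_part z = im_part w"
  by (cases z; cases w) auto

definition modulus :: "'a::banach_lattice complexification \<Rightarrow> 'a" where
  "modulus z = (LEAST m. \<forall>\<theta>. cos \<theta> *\<^sub>R re_part z + sin \<theta> *\<^sub>R im_part z \<le> m)"

lemma modulus_exists:
  fixes x y :: "'a::banach_lattice"
  shows "\<exists>m. (\<forall>\<theta>. cos \<theta> *\<^sub>R x + sin \<theta> *\<^sub>R y \<le> m) \<and>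
             (\<forall>m'. (\<forall>\<theta>. cos \<theta> *\<^sub>R x + sin \<theta> *\<^sub>R y \<le> m') \<longrightarrow> m \<le> m')"
proof -
  define p where "p c = Re c *\<^sub>R x + Im c *\<^sub>R y" for c
  define w where "w = \<bar>x\<bar> + \<bar>y\<bar>"
  define e where "e n = inverse (real (Suc n))" for n
  have w0: "0 \<le> w" by (simp add: w_def)
  have p_le: "p c \<le> p d + r *\<^sub>R w" if "dist d c < r" for c d r
  proof -
    have "\<bar>Re c - Re d\<bar> \<le> r" "\<bar>Im c - Im d\<bar> \<le> r"
      using that abs_Re_le_cmod[of "d - c"] abs_Im_le_cmod[of "d - c"]
      by (auto simp: dist_norm)
    hence "(Re c - Re d) *\<^sub>R x \<le> r *\<^sub>R \<bar>x\<bar>" "(Im c - Im d) *\<^sub>R y \<le> r *\<^sub>R \<bar>y\<bar>"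
      by (auto intro: abs_scaleR_le_banach_lattice)
    hence "(Re c - Re d) *\<^sub>R x + (Im c - Im d) *\<^sub>R y \<le> r *\<^sub>R w"
      unfolding w_def scaleR_add_right by (rule add_mono)
    moreover have "p c = p d + ((Re c - Re d) *\<^sub>R x + (Im c - Im d) *\<^sub>R y)"
      by (simp add: p_def algebra_simps)
    ultimately show ?thesis by simp
  qed
  have e0: "e n > 0" for n by (simp add: e_def)
  have e_lim: "e \<longlonglongrightarrow> 0"
    using LIMSEQ_inverse_real_of_nat by (simp add: e_def[abs_def])
  have "\<exists>k. finite k \<and> k \<subseteq> sphere (0::complex) 1 \<and> sphere 0 1 \<subseteq> (\<Union>c\<in>k. ball c (e n))" for n
    using seq_compact_imp_totally_bounded[OF compact_imp_seq_compact[OF compact_sphere], rule_format, OF e0] .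
  then obtain K where K: "finite (K n)" "K n \<subseteq> sphere (0::complex) 1"
     "sphere 0 1 \<subseteq> (\<Union>c\<in>K n. ball c (e n))" for n
    by metis
  have Kne: "K n \<noteq> {}" for n
  proof
    assume "K n = {}"
    hence "(1::complex) \<notin> sphere 0 1" using K(3)[of n] by auto
    thus False by simp
  qed
  define F where "F n = Sup_fin (p ` K n)" for n
  have F_ub: "p c \<le> F n" if "c \<in> K n" for c n
    unfolding F_def using that K(1) by (intro Sup_fin.coboundedI) auto
  have F_lub: "F n \<le> m" if "\<And>c. c \<in> sphere 0 1 \<Longrightarrow> p c \<le> m" for m n
    unfolding F_def
  proof (rule Sup_fin.boundedI)
    fix a assume "a \<in> p ` K n"
    thus "a \<le> m" using that K(2)[of n] by blast
  qed (use K(1) Kne in auto)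
  have pF: "p c \<le> F n + e n *\<^sub>R w" if "c \<in> sphere 0 1" for c n
  proof -
    have "c \<in> (\<Union>d\<in>K n. ball d (e n))" using K(3)[of n] that by (rule subsetD)
    then obtain d where d: "d \<in> K n" "dist d c < e n" by auto
    show ?thesis by (rule order_trans[OF p_le[OF d(2)] add_right_mono[OF F_ub[OF d(1)]]])
  qed
  have FF: "F m \<le> F n + e n *\<^sub>R w" for m n
    by (rule F_lub) (rule pF)
  have F_dist: "norm (F m - F n) \<le> max (e m) (e n) * norm w" for m n
  proof -
    have "e n *\<^sub>R w \<le> max (e m) (e n) *\<^sub>R w" by (rule scaleR_right_mono) (simp_all add: w0)
    hence "F m \<le> F n + max (e m) (e n) *\<^sub>R w"
      by (intro order_trans[OF FF[of m n]] add_left_mono)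
    hence "F m - F n \<le> max (e m) (e n) *\<^sub>R w" by (simp only: diff_le_eq add.commute)
    moreover have "e m *\<^sub>R w \<le> max (e m) (e n) *\<^sub>R w" by (rule scaleR_right_mono) (simp_all add: w0)
    hence "F n \<le> F m + max (e m) (e n) *\<^sub>R w"
      by (intro order_trans[OF FF[of n m]] add_left_mono)
    hence "F n - F m \<le> max (e m) (e n) *\<^sub>R w" by (simp only: diff_le_eq add.commute)
    ultimately have "\<bar>F m - F n\<bar> \<le> max (e m) (e n) *\<^sub>R w"
      by (intro abs_leI) simp_all
    hence "norm \<bar>F m - F n\<bar> \<le> norm (max (e m) (e n) *\<^sub>R w)"
      by (rule norm_mono_pos[OF abs_ge_zero])
    moreover have "0 \<le> max (e m) (e n)" using e0[of m] by linarith
    ultimately show ?thesis by simp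
  qed
  have "Cauchy F"
  proof (rule metric_CauchyI)
    fix r :: real assume "r > 0"
    have "(\<lambda>n. e n * norm w) \<longlonglongrightarrow> 0" using tendsto_mult_left_zero[OF e_lim] .
    hence "eventually (\<lambda>n. e n * norm w < r) sequentially"
      using \<open>r > 0\<close> by (rule order_tendstoD)
    then obtain N where N: "\<And>n. n \<ge> N \<Longrightarrow> e n * norm w < r"
      by (auto simp: eventually_sequentially)
    have "dist (F m) (F n) < r" if "m \<ge> N" "n \<ge> N" for m n
      using F_dist[of m n] N[OF that(1)] N[OF that(2)] by (auto simp: dist_norm max_def split: if_splits)
    thus "\<exists>M. \<forall>m\<ge>M. \<forall>n\<ge>M. dist (F m) (F n) < r" by blast
  qed
  then obtain L where L: "F \<longlonglongrightarrow> L" using Cauchy_convergent convergent_def by blast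
  have "(\<lambda>n. e n *\<^sub>R w) \<longlonglongrightarrow> 0 *\<^sub>R w" by (intro tendsto_intros e_lim)
  hence L': "(\<lambda>n. F n + e n *\<^sub>R w) \<longlonglongrightarrow> L" using tendsto_add[OF L, of "\<lambda>n. e n *\<^sub>R w" 0] by simp
  have pcis: "cos \<theta> *\<^sub>R x + sin \<theta> *\<^sub>R y = p (cis \<theta>)" for \<theta> by (simp add: p_def)
  have "cos \<theta> *\<^sub>R x + sin \<theta> *\<^sub>R y \<le> L" for \<theta>
    unfolding pcis by (rule banach_lattice_limit_mono[OF pF tendsto_const L']) simp
  moreover have "L \<le> m'" if m: "\<And>\<theta>. cos \<theta> *\<^sub>R x + sin \<theta> *\<^sub>R y \<le> m'" for m'
  proof (rule banach_lattice_limit_mono[OF F_lub L tendsto_const])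
    fix c :: complex assume "c \<in> sphere 0 1"
    hence "cis (Arg c) = c" using rcis_cmod_Arg[of c] by (simp add: rcis_def)
    thus "p c \<le> m'" using m[of "Arg c"] unfolding pcis by simp
  qed
  ultimately show ?thesis by blast
qed

lemma modulus_upper: "cos \<theta> *\<^sub>R re_part z + sin \<theta> *\<^sub>R im_part z \<le> modulus z"
  and modulus_least:
    "(\<And>\<theta>. cos \<theta> *\<^sub>R re_part z + sin \<theta> *\<^sub>R im_part z \<le> m) \<Longrightarrow> modulus z \<le> m"
proof -
  obtain m0 where m0: "\<forall>\<theta>. cos \<theta> *\<^sub>R re_part z + sin \<theta> *\<^sub>R im_part z \<le> m0"
    "\<forall>m'. (\<forall>\<theta>. cos \<theta> *\<^sub>R re_part z + sin \<theta> *\<^sub>R im_part z \<le> m') \<longrightarrow> m0 \<le> m'"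
    using modulus_exists[of "re_part z" "im_part z"] by blast
  have "modulus z = m0" unfolding modulus_def
    by (rule Least_equality) (use m0 in auto)
  thus "cos \<theta> *\<^sub>R re_part z + sin \<theta> *\<^sub>R im_part z \<le> modulus z"
    "(\<And>\<theta>. cos \<theta> *\<^sub>R re_part z + sin \<theta> *\<^sub>R im_part z \<le> m) \<Longrightarrow> modulus z \<le> m"
    using m0 by auto
qed

lemma abs_re_part_le_modulus: "\<bar>re_part z\<bar> \<le> modulus z"
  using modulus_upper[of 0 z] modulus_upper[of pi z] by (simp add: abs_le_iff)

lemma abs_im_part_le_modulus: "\<bar>im_part z\<bar> \<le> modulus z"
  using modulus_upper[of "pi/2" z] modulus_upper[of "-(pi/2)" z]
  by (simp only: cos_minus sin_minus cos_pi_half sin_pi_half) (simp add: abs_le_iff)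

lemma modulus_nonneg: "0 \<le> modulus z"
  using abs_re_part_le_modulus[of z] abs_ge_zero order_trans by blast

lemma modulus_le: "modulus z \<le> \<bar>re_part z\<bar> + \<bar>im_part z\<bar>"
proof (rule modulus_least, rule add_mono)
  fix \<theta> :: real
  show "cos \<theta> *\<^sub>R re_part z \<le> \<bar>re_part z\<bar>"
    using abs_scaleR_le_banach_lattice[of "cos \<theta>" 1 "re_part z"] by simp
  show "sin \<theta> *\<^sub>R im_part z \<le> \<bar>im_part z\<bar>"
    using abs_scaleR_le_banach_lattice[of "sin \<theta>" 1 "im_part z"] by simp
qed

instantiation complexification :: (banach_lattice) "{real_normed_vector, scaleC}"
begin

definition "0 = Complexify 0 0"
definition "z + w = Complexify (re_part z + re_part w) (im_part z + im_part w)"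
definition "- z = Complexify (- re_part z) (- im_part z)"
definition "z - w = Complexify (re_part z - re_part w) (im_part z - im_part w)"
definition "r *\<^sub>R z = Complexify (r *\<^sub>R re_part z) (r *\<^sub>R im_part z)"
definition "c *\<^sub>C z = Complexify (Re c *\<^sub>R re_part z - Im c *\<^sub>R im_part z)
                              (Re c *\<^sub>R im_part z + Im c *\<^sub>R re_part z)"
definition "norm z = norm (modulus z)"
definition "sgn (z :: 'a complexification) = inverse (norm z) *\<^sub>R z"
definition "dist z w = norm (z - w :: 'a complexification)"
definition uniformity_complexification [code del]:
  "(uniformity :: ('a complexification \<times> 'a complexification) filter) =
     (INF e\<in>{0 <..}. principal {(x, y). dist x y < e})"
definition open_complexification [code del]:
  "open (U :: 'a complexification set) \<longleftrightarrow>
     (\<forall>x\<in>U. eventually (\<lambda>(x', y). x' = x \<longrightarrow> y \<in> U) uniformity)"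

lemma complexification_sel [simp]:
  fixes z w :: "'a complexification"
  shows "re_part (0 :: 'a complexification) = 0" "im_part (0 :: 'a complexification) = 0"
    "re_part (z + w) = re_part z + re_part w" "im_part (z + w) = im_part z + im_part w"
    "re_part (- z) = - re_part z" "im_part (- z) = - im_part z"
    "re_part (z - w) = re_part z - re_part w" "im_part (z - w) = im_part z - im_part w"
    "re_part (r *\<^sub>R z) = r *\<^sub>R re_part z" "im_part (r *\<^sub>R z) = r *\<^sub>R im_part z"
    "re_part (c *\<^sub>C z) = Re c *\<^sub>R re_part z - Im c *\<^sub>R im_part z"
    "im_part (c *\<^sub>C z) = Re c *\<^sub>R im_part z + Im c *\<^sub>R re_part z"
  by (simp_all add: zero_complexification_def plus_complexification_def uminus_complexification_def
      minus_complexification_def scaleR_complexification_def scaleC_complexification_def)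

lemma modulus_add: "modulus (z + w) \<le> modulus z + modulus (w :: 'a complexification)"
proof (rule modulus_least)
  fix \<theta> :: real
  have "cos \<theta> *\<^sub>R re_part (z + w) + sin \<theta> *\<^sub>R im_part (z + w)
      = (cos \<theta> *\<^sub>R re_part z + sin \<theta> *\<^sub>R im_part z) + (cos \<theta> *\<^sub>R re_part w + sin \<theta> *\<^sub>R im_part w)"
    by (simp add: algebra_simps)
  also have "\<dots> \<le> modulus z + modulus w" by (intro add_mono modulus_upper)
  finally show "cos \<theta> *\<^sub>R re_part (z + w) + sin \<theta> *\<^sub>R im_part (z + w) \<le> modulus z + modulus w" .
qed

lemma modulus_scaleC_le: "modulus (c *\<^sub>C z) \<le> cmod c *\<^sub>R modulus (z :: 'a complexification)"
proof (rule modulus_least)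
  fix \<theta> :: real
  have c: "Re c = cmod c * cos (Arg c)" "Im c = cmod c * sin (Arg c)"
    using Re_rcis[of "cmod c" "Arg c"] Im_rcis[of "cmod c" "Arg c"] by (simp_all only: rcis_cmod_Arg)
  have "cos \<theta> *\<^sub>R re_part (c *\<^sub>C z) + sin \<theta> *\<^sub>R im_part (c *\<^sub>C z) =
    cmod c *\<^sub>R (cos (\<theta> - Arg c) *\<^sub>R re_part z + sin (\<theta> - Arg c) *\<^sub>R im_part z)"
    unfolding complexification_sel c cos_diff sin_diff
    by (simp only: algebra_simps scaleR_scaleR)
  also have "\<dots> \<le> cmod c *\<^sub>R modulus z" by (intro scaleR_left_mono modulus_upper) simp
  finally show "cos \<theta> *\<^sub>R re_part (c *\<^sub>C z) + sin \<theta> *\<^sub>R im_part (c *\<^sub>C z) \<le> cmod c *\<^sub>R modulus z" .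
qed

lemma modulus_scaleC: "modulus (c *\<^sub>C z) = cmod c *\<^sub>R modulus (z :: 'a complexification)"
proof (cases "c = 0")
  case True
  thus ?thesis
    using modulus_scaleC_le[of c z] modulus_nonneg[of "c *\<^sub>C z"] by (intro antisym) simp_all
next
  case False
  have "inverse c *\<^sub>C c *\<^sub>C z = z"
  proof -
    have "Re (inverse c) * Re c - Im (inverse c) * Im c = 1"
      "Re (inverse c) * Im c + Im (inverse c) * Re c = 0"
      using arg_cong[OF left_inverse[OF False], of Re] arg_cong[OF left_inverse[OF False], of Im]
      by (simp_all only: times_complex.sel one_complex.sel)
    moreover have "re_part (inverse c *\<^sub>C c *\<^sub>C z) =
        (Re (inverse c) * Re c - Im (inverse c) * Im c) *\<^sub>R re_part z
        - (Re (inverse c) * Im c + Im (inverse c) * Re c) *\<^sub>R im_part z"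
      "im_part (inverse c *\<^sub>C c *\<^sub>C z) =
        (Re (inverse c) * Re c - Im (inverse c) * Im c) *\<^sub>R im_part z
        + (Re (inverse c) * Im c + Im (inverse c) * Re c) *\<^sub>R re_part z"
      unfolding complexification_sel by (simp_all only: algebra_simps scaleR_scaleR)
    ultimately show ?thesis by (simp add: complexification_eq_iff)
  qed
  hence "modulus z \<le> inverse (cmod c) *\<^sub>R modulus (c *\<^sub>C z)"
    using modulus_scaleC_le[of "inverse c" "c *\<^sub>C z"] by (simp add: norm_inverse)
  hence "cmod c *\<^sub>R modulus z \<le> cmod c *\<^sub>R inverse (cmod c) *\<^sub>R modulus (c *\<^sub>C z)"
    by (intro scaleR_left_mono) auto
  hence "cmod c *\<^sub>R modulus z \<le> modulus (c *\<^sub>C z)" using False by simp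
  with modulus_scaleC_le[of c z] show ?thesis by (rule antisym)
qed

lemma scaleC_of_real_complexification:
  "complex_of_real r *\<^sub>C (z :: 'a complexification) = r *\<^sub>R z"
  by (simp add: complexification_eq_iff)

instance
proof
  fix r s :: real and x y z :: "'a complexification" and U :: "'a complexification set"
  show "x + y + z = x + (y + z)" "x + y = y + x" "0 + x = x" "- x + x = 0" "x - y = x + - y"
    "r *\<^sub>R (x + y) = r *\<^sub>R x + r *\<^sub>R y" "(r + s) *\<^sub>R x = r *\<^sub>R x + s *\<^sub>R x"
    "r *\<^sub>R s *\<^sub>R x = (r * s) *\<^sub>R x" "1 *\<^sub>R x = x"
    by (simp_all add: complexification_eq_iff algebra_simps)
  show "sgn x = inverse (norm x) *\<^sub>R x" by (rule sgn_complexification_def)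
  show "dist x y = norm (x - y)" by (rule dist_complexification_def)
  show "(uniformity :: ('a complexification \<times> 'a complexification) filter) =
     (INF e\<in>{0 <..}. principal {(x, y). dist x y < e})" by (rule uniformity_complexification)
  show "open U \<longleftrightarrow> (\<forall>x\<in>U. eventually (\<lambda>(x', y). x' = x \<longrightarrow> y \<in> U) uniformity)"
    by (rule open_complexification)
  show "norm x = 0 \<longleftrightarrow> x = 0"
  proof
    assume "norm x = 0"
    hence "modulus x = 0" by (simp add: norm_complexification_def)
    thus "x = 0"
      using abs_re_part_le_modulus[of x] abs_im_part_le_modulus[of x]
      by (simp add: complexification_eq_iff)
  next
    assume "x = 0"
    hence "modulus x \<le> 0" using modulus_le[of x] by simp
    hence "modulus x = 0" using modulus_nonneg[of x] by (rule antisym)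
    thus "norm x = 0" by (simp add: norm_complexification_def)
  qed
  show "norm (x + y) \<le> norm x + norm y"
  proof -
    have "norm (modulus (x + y)) \<le> norm (modulus x + modulus y)"
      by (intro norm_mono_pos modulus_nonneg modulus_add)
    also have "\<dots> \<le> norm (modulus x) + norm (modulus y)" by (rule norm_triangle_ineq)
    finally show ?thesis by (simp add: norm_complexification_def)
  qed
  show "norm (r *\<^sub>R x) = \<bar>r\<bar> * norm x"
    by (simp add: scaleC_of_real_complexification[symmetric] norm_complexification_def
        modulus_scaleC)
qed

end

lemma norm_re_part_le: "norm (re_part z) \<le> norm z"
  and norm_im_part_le: "norm (im_part z) \<le> norm z"
  and norm_complexification_le: "norm z \<le> norm (re_part z) + norm (im_part z)"
proof -
  have "norm \<bar>re_part z\<bar> \<le> norm (modulus z)" "norm \<bar>im_part z\<bar> \<le> norm (modulus z)"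
    by (intro norm_mono_pos abs_re_part_le_modulus abs_im_part_le_modulus abs_ge_zero)+
  thus "norm (re_part z) \<le> norm z" "norm (im_part z) \<le> norm z"
    by (simp_all add: norm_complexification_def)
  have "norm (modulus z) \<le> norm (\<bar>re_part z\<bar> + \<bar>im_part z\<bar>)"
    by (intro norm_mono_pos modulus_nonneg modulus_le)
  also have "\<dots> \<le> norm (re_part z) + norm (im_part z)"
    using norm_triangle_ineq[of "\<bar>re_part z\<bar>" "\<bar>im_part z\<bar>"] by simp
  finally show "norm z \<le> norm (re_part z) + norm (im_part z)"
    by (simp add: norm_complexification_def)
qed

instance complexification :: (banach_lattice) complex_banach
proof
  fix c d :: complex and r :: real and x y :: "'a complexification"
  show "c *\<^sub>C (x + y) = c *\<^sub>C x + c *\<^sub>C y" "(c + d) *\<^sub>C x = c *\<^sub>C x + d *\<^sub>C x"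
    "c *\<^sub>C d *\<^sub>C x = (c * d) *\<^sub>C x"
    by (simp_all add: complexification_eq_iff algebra_simps)
  show "complex_of_real r *\<^sub>C x = r *\<^sub>R x" by (rule scaleC_of_real_complexification)
  show "norm (c *\<^sub>C x) = cmod c * norm x"
    by (simp add: norm_complexification_def modulus_scaleC)
next
  fix X :: "nat \<Rightarrow> 'a complexification"
  assume X: "Cauchy X"
  have re: "dist (re_part (X m)) (re_part (X n)) \<le> dist (X m) (X n)"
    and im: "dist (im_part (X m)) (im_part (X n)) \<le> dist (X m) (X n)" for m n
    using norm_re_part_le[of "X m - X n"] norm_im_part_le[of "X m - X n"] by (simp_all add: dist_norm)
  have "Cauchy (\<lambda>n. re_part (X n))"
    using X unfolding Cauchy_def by (meson re order_le_less_trans)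
  then obtain a where a: "(\<lambda>n. re_part (X n)) \<longlonglongrightarrow> a"
    by (blast dest: Cauchy_convergent convergentD)
  have "Cauchy (\<lambda>n. im_part (X n))"
    using X unfolding Cauchy_def by (meson im order_le_less_trans)
  then obtain b where b: "(\<lambda>n. im_part (X n)) \<longlonglongrightarrow> b"
    by (blast dest: Cauchy_convergent convergentD)
  have "(\<lambda>n. norm (re_part (X n) - a) + norm (im_part (X n) - b)) \<longlonglongrightarrow> 0 + 0"
    by (intro tendsto_add tendsto_norm_zero LIM_zero a b)
  hence lim: "(\<lambda>n. norm (re_part (X n) - a) + norm (im_part (X n) - b)) \<longlonglongrightarrow> 0" by simp
  have "norm (X n - Complexify a b) \<le> norm (re_part (X n) - a) + norm (im_part (X n) - b)" for n
    using norm_complexification_le[of "X n - Complexify a b"] by simp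
  hence "(\<lambda>n. X n - Complexify a b) \<longlonglongrightarrow> 0"
    by (intro Lim_null_comparison[OF _ lim] always_eventually) simp
  hence "X \<longlonglongrightarrow> Complexify a b" by (rule LIM_zero_cancel)
  thus "convergent X" by (rule convergentI)
qed

text \<open>
  The order on \<open>E\<close> is the one induced by the positive cone \<open>E\<^sub>+ \<subseteq> E\<^sub>\<real>\<close>, that is,
  \<open>z \<le> w\<close> iff \<open>w - z\<close> is real and positive.
\<close>

instantiation complexification :: (banach_lattice) "{ordered_real_vector, abs}"
begin

definition "z \<le> w \<longleftrightarrow> re_part z \<le> re_part w \<and> im_part z = im_part w"
definition "z < w \<longleftrightarrow> z \<le> w \<and> z \<noteq> (w :: 'a complexification)"
definition "\<bar>z\<bar> = Complexify (modulus z) 0"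

instance
  by standard
    (auto simp: less_eq_complexification_def less_complexification_def complexification_eq_iff
      intro: scaleR_left_mono scaleR_right_mono)

end

definition real_part :: "'a::banach_lattice complexification set" where
  "real_part = {f. im_part f = 0}"

definition principal_ideal ::
    "'a::banach_lattice complexification \<Rightarrow> 'a complexification set" where
  "principal_ideal u = {f. \<exists>c\<ge>0. \<bar>f\<bar> \<le> c *\<^sub>R u}"

definition quasi_interior :: "'a::banach_lattice complexification \<Rightarrow> bool" where
  "quasi_interior u \<longleftrightarrow> 0 \<le> u \<and> closure (principal_ideal u) = UNIV"

definition strongly_pos ::
    "'a::banach_lattice complexification \<Rightarrow> 'a complexification \<Rightarrow> bool" where
  "strongly_pos u f \<longleftrightarrow> 0 \<le> f \<and> (\<exists>\<epsilon>>0. \<epsilon> *\<^sub>R u \<le> f)"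

definition strongly_pos_op ::
    "'a::banach_lattice complexification \<Rightarrow>
     ('a complexification \<Rightarrow>\<^sub>L 'a complexification) \<Rightarrow> bool" where
  "strongly_pos_op u S \<longleftrightarrow> (\<forall>f>0. strongly_pos u (S f))"


section \<open>Semigroups, spectrum and resolvent\<close>

definition C0_semigroup :: "(real \<Rightarrow> 'a::complex_banach \<Rightarrow>\<^sub>L 'a) \<Rightarrow> bool" where
  "C0_semigroup T \<longleftrightarrow>
     (\<forall>t\<ge>0. \<forall>c f. T t (c *\<^sub>C f) = c *\<^sub>C T t f) \<and>
     T 0 = id_blinfun \<and>
     (\<forall>s\<ge>0. \<forall>t\<ge>0. T (s + t) = T s o\<^sub>L T t) \<and>
     (\<forall>f. ((\<lambda>t. T t f) \<longlongrightarrow> f) (at_right 0))"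

text \<open>Unbounded operators are partial maps; \<open>dom A\<close> is the domain of \<open>A\<close>.\<close>

definition generator :: "(real \<Rightarrow> 'a::complex_banach \<Rightarrow>\<^sub>L 'a) \<Rightarrow> 'a \<rightharpoonup> 'a" where
  "generator T f =
     (if \<exists>g. ((\<lambda>h. (T h f - f) /\<^sub>R h) \<longlongrightarrow> g) (at_right 0)
      then Some (Lim (at_right 0) (\<lambda>h. (T h f - f) /\<^sub>R h))
      else None)"

text \<open>
  For complex-linear \<open>A\<close> the inverse below is automatically complex-linear, so boundedness is the only
  content of \<open>bounded_linear\<close>.
\<close>

definition resolvent_set :: "('a::complex_banach \<rightharpoonup> 'a) \<Rightarrow> complex set" where
  "resolvent_set A =
     {\<mu>. bij_betw (\<lambda>f. \<mu> *\<^sub>C f - the (A f)) (dom A) UNIV \<and>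
          bounded_linear (inv_into (dom A) (\<lambda>f. \<mu> *\<^sub>C f - the (A f)))}"

definition spectrum :: "('a::complex_banach \<rightharpoonup> 'a) \<Rightarrow> complex set" where
  "spectrum A = - resolvent_set A"

definition resolvent :: "('a::complex_banach \<rightharpoonup> 'a) \<Rightarrow> complex \<Rightarrow> 'a \<Rightarrow>\<^sub>L 'a" where
  "resolvent A \<mu> = Blinfun (inv_into (dom A) (\<lambda>f. \<mu> *\<^sub>C f - the (A f)))"

definition spectral_bound :: "('a::complex_banach \<rightharpoonup> 'a) \<Rightarrow> ereal" where
  "spectral_bound A = (SUP \<mu>\<in>spectrum A. ereal (Re \<mu>))"

text \<open>
  A pole of a function with values in a complex Banach space is an isolated singularity at which
  the Laurent expansion has a finite, nonzero principal part.  The predicate \<open>is_pole\<close> of HOL-Complex_Analysis only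
  says \<open>\<parallel>F z\<parallel> \<rightarrow> \<infinity>\<close>, which for vector-valued functions also holds at some essential singularities
  (e.g.\ at \<open>0\<close> for the resolvent of a quasinilpotent, non-nilpotent operator).
\<close>

definition vector_pole_on :: "complex set \<Rightarrow> (complex \<Rightarrow> 'b::complex_banach) \<Rightarrow> complex \<Rightarrow> bool"
  where
  "vector_pole_on D F z\<^sub>0 \<longleftrightarrow>
     (\<exists>r>0. \<exists>k>0. \<exists>U :: nat \<Rightarrow> 'b. U 0 \<noteq> 0 \<and>
        (\<forall>z\<in>ball z\<^sub>0 r - {z\<^sub>0}. z \<in> D \<and>
           (\<lambda>n. (z - z\<^sub>0) powi (int n - int k) *\<^sub>C U n) sums F z))"

definition pole_of_resolvent :: "('a::complex_banach \<rightharpoonup> 'a) \<Rightarrow> complex \<Rightarrow> bool" where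
  "pole_of_resolvent A \<mu>\<^sub>0 \<longleftrightarrow> vector_pole_on (resolvent_set A) (resolvent A) \<mu>\<^sub>0"

text \<open>
  The spectral projection of an isolated point \<open>\<mu>\<^sub>0\<close> of the spectrum is
  \<open>(1 / 2\<pi>i) \<integral> R(\<mu>, A) d\<mu>\<close> over small circles around \<open>\<mu>\<^sub>0\<close>.  Contour integrals in the library are
  complex-valued only, so the circle is parametrised by \<open>\<theta> \<mapsto> \<mu>\<^sub>0 + r e\<^bsup>i\<theta>\<^esup>\<close>, with
  \<open>d\<mu> / 2\<pi>i = r e\<^bsup>i\<theta>\<^esup> d\<theta> / 2\<pi>\<close>.
\<close>

definition spectral_projection :: "('a::complex_banach \<rightharpoonup> 'a) \<Rightarrow> complex \<Rightarrow> 'a \<Rightarrow>\<^sub>L 'a" where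
  "spectral_projection A \<mu>\<^sub>0 =
     (THE P. \<forall>\<^sub>F r in at_right (0::real).
        ((\<lambda>\<theta>. (of_real (r / (2 * pi)) * cis \<theta>) *\<^sub>C resolvent A (\<mu>\<^sub>0 + of_real r * cis \<theta>))
           has_integral P) {0..2 * pi})"

definition real_semigroup ::
    "(real \<Rightarrow> 'a::banach_lattice complexification \<Rightarrow>\<^sub>L 'a complexification) \<Rightarrow> bool" where
  "real_semigroup T \<longleftrightarrow> (\<forall>t\<ge>0. blinfun_apply (T t) ` real_part \<subseteq> real_part)"

definition individually_eventually_strongly_pos ::
    "'a::banach_lattice complexification \<Rightarrow>
     (real \<Rightarrow> 'a complexification \<Rightarrow>\<^sub>L 'a complexification) \<Rightarrow> bool" where
  "individually_eventually_strongly_pos u T \<longleftrightarrow>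
     (\<forall>f>0. \<exists>t\<^sub>0\<ge>0. \<forall>t\<ge>t\<^sub>0. strongly_pos u (T t f))"

end

theory Submission
  imports Defs
begin

text \<open>
  Let \<open>s\<close> be the spectral bound, \<open>k\<close> the order of the pole of the resolvent \<open>R(y, A)\<close> at \<open>s\<close>, and
  \<open>Q = lim (y - s)\<^sup>k R(y, A)\<close> for \<open>y \<rightarrow> s\<close> from the right, the nonzero leading Laurent coefficient.  The
  theorem is proved for \<open>Q\<close> first; that \<open>Q\<close> is the spectral projection comes out at the end.

  The resolvent identity shows that \<open>Q\<close> maps into the eigenspace of \<open>A\<close> for \<open>s\<close>, so that
  \<open>Q T(t) = T(t) Q = e\<^bsup>s t\<^esup> Q\<close> (\<open>semigroup_leading_coefficient\<close>).

  The operator \<open>Q\<close> is positive.  The vectors \<open>g\<close> with \<open>T(t) g \<ge> 0\<close> for all \<open>t \<ge> 0\<close> form a closed convex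
  cone that the semigroup maps into itself.  Any such cone is mapped into itself by \<open>R(y, A)\<close> for every
  \<open>y > s\<close> (\<open>resolvent_invariant_cone\<close>), hence by \<open>Q\<close>.  If \<open>f \<ge> 0\<close>, then \<open>T(t) f\<close> lies in this cone for
  some \<open>t\<close>, and \<open>e\<^bsup>s t\<^esup> Q f = Q T(t) f \<ge> 0\<close>.

  The operator \<open>Q\<close> is strongly positive.  As \<open>Q\<close> is positive and nonzero and \<open>u\<close> is quasi-interior, \<open>Q u > 0\<close>
  (\<open>positive_operator_zero_at_quasi_interior\<close>).  Then \<open>e\<^bsup>s t\<^esup> Q u = T(t) (Q u)\<close> dominates a positive multiple of
  \<open>u\<close> for large \<open>t\<close>, so \<open>Q u \<ge> \<delta> u\<close> with \<open>\<delta> > 0\<close>.  For \<open>f > 0\<close>, \<open>T(t) f \<ge> \<epsilon> u\<close> for large \<open>t\<close>, and applying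
  \<open>Q\<close> gives \<open>e\<^bsup>s t\<^esup> Q f \<ge> \<epsilon> Q u \<ge> \<epsilon> \<delta> u\<close>.

  The pole is simple.  For \<open>k \<ge> 2\<close> the leading coefficient has square zero (\<open>leading_coefficient_nilpotent\<close>),
  but \<open>Q (Q u) \<ge> \<delta> Q u > 0\<close>.  Hence \<open>k = 1\<close>, and \<open>Q\<close> is the residue of the resolvent, which is the spectral
  projection.
\<close>

section \<open>Complex scalars, fixed points and integrals in cones\<close>

lemma scaleC_one: "1 *\<^sub>C x = (x :: 'a::complex_banach)"
  using scaleC_of_real[of 1 x] by simp

lemma bounded_bilinear_scaleC:
  "bounded_bilinear ((*\<^sub>C) :: complex \<Rightarrow> 'a::complex_banach \<Rightarrow> 'a)"
proof
  fix a b :: complex and r :: real and x y :: 'a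
  show "(a + b) *\<^sub>C x = a *\<^sub>C x + b *\<^sub>C x" by (rule scaleC_add_left)
  show "a *\<^sub>C (x + y) = a *\<^sub>C x + a *\<^sub>C y" by (rule scaleC_add_right)
  show "(r *\<^sub>R a) *\<^sub>C x = r *\<^sub>R a *\<^sub>C x"
    by (simp add: scaleC_of_real[symmetric] scaleC_scaleC scaleR_conv_of_real)
  show "a *\<^sub>C r *\<^sub>R x = r *\<^sub>R a *\<^sub>C x"
    by (simp add: scaleC_of_real[symmetric] scaleC_scaleC mult.commute)
  show "\<exists>K. \<forall>a (x::'a). norm (a *\<^sub>C x) \<le> norm a * norm x * K"
    by (rule exI[of _ 1]) (simp add: norm_scaleC)
qed

interpretation scaleC: bounded_bilinear "(*\<^sub>C) :: complex \<Rightarrow> 'a::complex_banach \<Rightarrow> 'a"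
  by (rule bounded_bilinear_scaleC)

text \<open>
  The Banach--Steinhaus theorem.  By Baire, one of the closed sets \<open>V n\<close> of points at which the whole
  family is bounded by \<open>n\<close> contains a ball, and differences of points of that ball reach every direction.
\<close>

lemma uniform_boundedness:
  fixes F :: "'i \<Rightarrow> 'a::banach \<Rightarrow>\<^sub>L 'b::real_normed_vector"
  assumes pt: "\<And>x. \<exists>B. \<forall>i\<in>I. norm (F i x) \<le> B"
  shows "\<exists>B. \<forall>i\<in>I. norm (F i) \<le> B"
proof -
  define V where "V n = {x. \<forall>i\<in>I. norm (F i x) \<le> real n}" for n
  have V_Int: "V n = (\<Inter>i\<in>I. {x. norm (F i x) \<le> real n})" for n by (auto simp: V_def)
  have closed_V: "closed (V n)" for n
    unfolding V_Int by (intro closed_INT ballI closed_Collect_le continuous_intros)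
  have "\<exists>n. x \<in> V n" for x
  proof -
    obtain B where B: "\<forall>i\<in>I. norm (F i x) \<le> B" using pt by blast
    obtain n where "B \<le> real n" using real_arch_simple by blast
    thus ?thesis using B order_trans unfolding V_def by blast
  qed
  hence cover: "\<Union>(range V) = UNIV" by auto
  have "\<exists>n. interior (V n) \<noteq> {}"
  proof (rule ccontr)
    assume "\<not> ?thesis"
    hence "euclidean interior_of \<Union>(range V) = {}"
      using closed_V
      by (intro Baire_category_alt) (auto simp: completely_metrizable_space_euclidean)
    thus False by (simp add: cover)
  qed
  then obtain n x where "x \<in> interior (V n)" by blast
  then obtain r where r: "r > 0" "cball x r \<subseteq> V n" by (auto simp: mem_interior_cball)
  have "norm (F i) \<le> 2 * real n / r" if i: "i \<in> I" for i
  proof (rule norm_blinfun_bound)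
    fix y :: 'a
    show "norm (F i y) \<le> 2 * real n / r * norm y"
    proof (cases "y = 0")
      case False
      define z where "z = (r / norm y) *\<^sub>R y"
      have "norm z = r" using False r by (simp add: z_def)
      hence "x + z \<in> V n" "x \<in> V n" using r by (auto simp: dist_norm intro!: subsetD[OF r(2)])
      hence "norm (F i (x + z)) \<le> n" "norm (F i x) \<le> n" using i by (auto simp: V_def)
      moreover have "F i z = F i (x + z) - F i x" by (simp add: blinfun.add_right)
      ultimately have "norm (F i z) \<le> 2 * real n"
        using norm_triangle_ineq4[of "F i (x + z)" "F i x"] by simp
      moreover have "norm (F i z) = r / norm y * norm (F i y)"
        using r by (simp add: z_def blinfun.scaleR_right)
      ultimately show ?thesis using r False by (simp add: field_simps)
    qed (simp add: blinfun.zero_right)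
  qed (use r in simp)
  thus ?thesis by blast
qed

text \<open>
  The iterates of \<open>x \<mapsto> a + L x\<close> started at \<open>0\<close> stay in \<open>C\<close> and converge to \<open>h\<close>.  Applied to cones, this
  replaces both the Neumann series and the Laplace transform representation of the resolvent.
\<close>

lemma closed_fixed_point_iteration:
  fixes L :: "'a::real_normed_vector \<Rightarrow>\<^sub>L 'a"
  assumes C: "closed C" "0 \<in> C" "\<And>x. x \<in> C \<Longrightarrow> a + L x \<in> C"
    and h: "h = a + L h" and L: "norm L < 1"
  shows "h \<in> C"
proof -
  define x where "x n = ((\<lambda>y. a + L y) ^^ n) 0" for n
  have x_C: "x n \<in> C" for n by (induction n) (auto simp: x_def C)
  have est: "norm (x n - h) \<le> norm L ^ n * norm h" for n
  proof (induction n)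
    case (Suc n)
    have "x (Suc n) - h = (a + L (x n)) - (a + L h)"
      by (subst h) (simp add: x_def)
    hence "norm (x (Suc n) - h) = norm (L (x n - h))" by (simp add: blinfun.diff_right)
    also have "\<dots> \<le> norm L * norm (x n - h)" by (rule norm_blinfun)
    also have "\<dots> \<le> norm L * (norm L ^ n * norm h)" by (intro mult_left_mono Suc) simp
    finally show ?case by simp
  qed (simp add: x_def)
  have "(\<lambda>n. norm L ^ n * norm h) \<longlonglongrightarrow> 0"
    using L by (intro tendsto_mult_left_zero LIMSEQ_power_zero) simp
  hence "(\<lambda>n. x n - h) \<longlonglongrightarrow> 0"
    by (rule Lim_null_comparison[rotated]) (simp add: est)
  hence "x \<longlonglongrightarrow> h" by (rule LIM_zero_cancel)
  thus ?thesis using C(1) x_C closed_sequentially by blast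
qed

text \<open>
  Riemann sums are combinations of values of \<open>f\<close> with nonnegative coefficients.
\<close>

lemma has_integral_in_closed_convex_cone:
  fixes f :: "real \<Rightarrow> 'a::real_normed_vector"
  assumes C: "closed C" "0 \<in> C" "\<And>x y. x \<in> C \<Longrightarrow> y \<in> C \<Longrightarrow> x + y \<in> C"
      "\<And>r x. 0 \<le> r \<Longrightarrow> x \<in> C \<Longrightarrow> r *\<^sub>R x \<in> C"
    and int: "(f has_integral J) {a..b}" and f: "\<And>x. x \<in> {a..b} \<Longrightarrow> f x \<in> C"
  shows "J \<in> C"
proof -
  have "\<exists>y\<in>C. dist y J < e" if "e > 0" for e
  proof -
    obtain \<gamma> where \<gamma>: "gauge \<gamma>"
      and fine: "\<And>p. p tagged_division_of {a..b} \<Longrightarrow> \<gamma> fine p \<Longrightarrow>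
        norm ((\<Sum>(x, k)\<in>p. measure lborel k *\<^sub>R f x) - J) < e"
      using int \<open>e > 0\<close> unfolding has_integral_real by meson
    obtain p where p: "p tagged_division_of cbox a b" "\<gamma> fine p"
      using fine_division_exists[OF \<gamma>] by blast
    have C_sum: "sum g p \<in> C" if "\<And>i. i \<in> p \<Longrightarrow> g i \<in> C" for g
      using that by (induction p rule: infinite_finite_induct) (auto intro: C)
    have "(\<Sum>(x, k)\<in>p. measure lborel k *\<^sub>R f x) \<in> C"
      using tag_in_interval[OF p(1)] by (intro C_sum) (auto intro!: C f)
    thus ?thesis using fine[of p] p by (force simp: dist_norm)
  qed
  thus ?thesis using C(1) closed_approachable by blast
qed

section \<open>Strongly continuous semigroups\<close>

lemma C0_semigroup_scaleC: "C0_semigroup T \<Longrightarrow> 0 \<le> t \<Longrightarrow> T t (c *\<^sub>C f) = c *\<^sub>C T t f"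
  and C0_semigroup_0: "C0_semigroup T \<Longrightarrow> T 0 f = f"
  and C0_semigroup_add: "C0_semigroup T \<Longrightarrow> 0 \<le> s \<Longrightarrow> 0 \<le> t \<Longrightarrow> T (s + t) f = T s (T t f)"
  and C0_semigroup_tendsto: "C0_semigroup T \<Longrightarrow> ((\<lambda>t. T t f) \<longlongrightarrow> f) (at_right 0)"
  by (simp_all add: C0_semigroup_def)

lemma C0_semigroup_commute:
  assumes "C0_semigroup T" "0 \<le> s" "0 \<le> t"
  shows "T s (T t f) = T t (T s f)"
  using C0_semigroup_add[OF assms, of f] C0_semigroup_add[OF assms(1,3,2), of f]
  by (simp add: add.commute)

text \<open>
  Along a null sequence on which the norms blow up, the orbits would still converge, contradicting
  uniform boundedness.
\<close>

lemma C0_semigroup_bounded_near_0: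
  assumes T: "C0_semigroup T"
  obtains \<delta> M where "0 < \<delta>" "\<And>t. 0 \<le> t \<Longrightarrow> t \<le> \<delta> \<Longrightarrow> norm (T t) \<le> M"
proof (rule ccontr)
  assume not_thesis: "\<not> thesis"
  have "\<exists>t. 0 \<le> t \<and> t \<le> inverse (Suc n) \<and> real n < norm (T t)" for n
  proof (rule ccontr)
    assume "\<not> ?thesis"
    hence "norm (T t) \<le> real n" if "0 \<le> t" "t \<le> inverse (Suc n)" for t
      using that by (meson not_le)
    thus False using not_thesis that[of "inverse (Suc n)" "real n"] by fastforce
  qed
  then obtain t where t: "\<And>n. 0 \<le> t n" "\<And>n. t n \<le> inverse (Suc n)"
    "\<And>n. real n < norm (T (t n))" by metis
  have t_lim: "t \<longlonglongrightarrow> 0"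
    using t by (intro tendsto_sandwich[OF _ _ tendsto_const LIMSEQ_inverse_real_of_nat]) auto
  have lim: "(\<lambda>n. T (t n) f) \<longlonglongrightarrow> f" for f
  proof -
    have "((\<lambda>s. T s f) \<longlongrightarrow> T 0 f) (at 0 within {0..})"
      using C0_semigroup_tendsto[OF T, of f]
      by (simp add: C0_semigroup_0[OF T] at_within_Ici_at_right)
    hence "continuous (at 0 within {0..}) (\<lambda>s. T s f)" by (simp add: continuous_within)
    hence "(\<lambda>n. T (t n) f) \<longlonglongrightarrow> T 0 f"
      using t_lim t(1) unfolding continuous_within_sequentially by (auto simp: o_def)
    thus ?thesis by (simp add: C0_semigroup_0[OF T])
  qed
  have "\<exists>B. \<forall>n\<in>UNIV. norm (T (t n) f) \<le> B" for f
    using convergent_imp_Bseq[OF convergentI[OF lim]] by (auto simp: Bseq_def)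
  then obtain B where "\<And>n. norm (T (t n)) \<le> B"
    using uniform_boundedness[of UNIV "\<lambda>n. T (t n)"] by auto
  moreover obtain n where "B \<le> real n" using real_arch_simple by blast
  ultimately show False using t(3)[of n] by (meson not_le order_trans)
qed

text \<open>
  Right continuity follows from the semigroup law.  On the left, \<open>T t f - T (t - h) f = T (t - h) (T h f - f)\<close>,
  so a bound on the operators just to the left of \<open>t\<close> is required; the bound near \<open>0\<close> is transported there
  by the semigroup law.
\<close>

lemma C0_semigroup_continuous_on:
  assumes T: "C0_semigroup T"
  shows "continuous_on {0..} (\<lambda>t. T t f)"
proof -
  obtain \<delta> M where \<delta>: "0 < \<delta>" and M: "\<And>t. 0 \<le> t \<Longrightarrow> t \<le> \<delta> \<Longrightarrow> norm (T t) \<le> M"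
    using C0_semigroup_bounded_near_0[OF T] by blast
  have M0: "0 \<le> M" using order_trans[OF norm_ge_zero M[of 0]] \<delta> by simp
  have lim0: "((\<lambda>h. norm (T h f - f)) \<longlongrightarrow> 0) (at_right 0)"
    using C0_semigroup_tendsto[OF T, of f] by (simp add: LIM_zero_iff tendsto_norm_zero)
  have "((\<lambda>t. T t f) \<longlongrightarrow> T t f) (at t within {0..})" if t: "0 \<le> t" for t
  proof (rule tendstoI)
    fix e :: real assume "e > 0"
    define a where "a = max 0 (t - \<delta>)"
    define N where "N = norm (T a) * M"
    \<comment> \<open>For \<open>s\<close> in \<open>[a, t]\<close> one has \<open>s - a \<le> \<delta>\<close>, so \<open>T s = T a T (s - a)\<close> is bounded by \<open>N\<close>.\<close>
    have near: "norm (T s) \<le> N" if "a \<le> s" "s \<le> t" for s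
    proof -
      have "T s = T a o\<^sub>L T (s - a)"
        using that by (intro blinfun_eqI)
          (simp add: a_def C0_semigroup_add[OF T, symmetric])
      hence "norm (T s) \<le> norm (T a) * norm (T (s - a))" by (simp add: norm_blinfun_compose)
      also have "\<dots> \<le> N" unfolding N_def using that by (intro mult_left_mono M) (auto simp: a_def)
      finally show ?thesis .
    qed
    have N0: "0 \<le> N" using M0 by (simp add: N_def)
    have at: "a \<le> t" using t \<delta> by (simp add: a_def)
    have inc: "norm (T (s + h) f - T s f) \<le> N * norm (T h f - f)" if "a \<le> s" "s \<le> t" "0 \<le> h" for s h
    proof -
      have "T (s + h) f - T s f = T s (T h f - f)"
        using that by (simp add: a_def C0_semigroup_add[OF T] blinfun.diff_right)
      hence "norm (T (s + h) f - T s f) \<le> norm (T s) * norm (T h f - f)" by (simp add: norm_blinfun)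
      also have "\<dots> \<le> N * norm (T h f - f)" using that by (intro mult_right_mono near) auto
      finally show ?thesis .
    qed
    have "((\<lambda>h. N * norm (T h f - f)) \<longlongrightarrow> 0) (at_right 0)" using tendsto_mult_right_zero[OF lim0] .
    hence "eventually (\<lambda>h. N * norm (T h f - f) < e) (at_right 0)"
      using \<open>e > 0\<close> by (rule order_tendstoD)
    then obtain d where d: "d > 0" "\<And>h. 0 < h \<Longrightarrow> h < d \<Longrightarrow> N * norm (T h f - f) < e"
      unfolding eventually_at_right_field by auto
    have "dist (T s f) (T t f) < e" if s: "0 \<le> s" "dist s t < min d \<delta>" for s
    proof (cases "s = t")
      case False
      define h where "h = \<bar>s - t\<bar>"
      have h: "0 < h" "h < d" "h < \<delta>" using False s by (auto simp: h_def dist_real_def)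
      have as: "a \<le> s" using s by (auto simp: a_def dist_real_def)
      have "norm (T s f - T t f) \<le> N * norm (T h f - f)"
      proof (cases "t \<le> s")
        case True
        thus ?thesis using inc[of t h] h at by (simp add: h_def)
      next
        case False
        thus ?thesis using inc[of s h] h as by (simp add: h_def norm_minus_commute)
      qed
      thus ?thesis using d(2)[OF h(1,2)] by (simp add: dist_norm)
    qed (simp add: \<open>e > 0\<close>)
    thus "eventually (\<lambda>s. dist (T s f) (T t f) < e) (at t within {0..})"
      unfolding eventually_at using d(1) \<delta> by (intro exI[of _ "min d \<delta>"]) auto
  qed
  thus ?thesis by (simp add: continuous_on_def)
qed

lemma C0_semigroup_locally_bounded:
  assumes T: "C0_semigroup T"
  shows "\<exists>M\<ge>0. \<forall>t\<in>{0..\<tau>}. norm (T t) \<le> M"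
proof -
  have "\<exists>B. \<forall>t\<in>{0..\<tau>}. norm (T t f) \<le> B" for f
  proof -
    have "continuous_on {0..\<tau>} (\<lambda>t. T t f)"
      by (rule continuous_on_subset[OF C0_semigroup_continuous_on[OF T]]) auto
    hence "bounded ((\<lambda>t. T t f) ` {0..\<tau>})"
      by (intro compact_imp_bounded compact_continuous_image) auto
    thus ?thesis by (auto simp: bounded_iff)
  qed
  then obtain B where "\<forall>t\<in>{0..\<tau>}. norm (T t) \<le> B" using uniform_boundedness[of "{0..\<tau>}" T] by auto
  thus ?thesis by (intro exI[of _ "max 0 B"]) (auto simp: le_max_iff_disj)
qed

text \<open>
  Its generator is \<open>A - c\<close>, so statements about \<open>c - A\<close> reduce to the case \<open>c = 0\<close>.
\<close>

definition rescaled ::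
    "complex \<Rightarrow> (real \<Rightarrow> 'a::complex_banach \<Rightarrow>\<^sub>L 'a) \<Rightarrow> real \<Rightarrow> 'a \<Rightarrow>\<^sub>L 'a" where
  "rescaled c T t = exp (- c * of_real t) *\<^sub>C T t"

lemma rescaled_apply: "rescaled c T t f = exp (- c * of_real t) *\<^sub>C T t f"
  by (simp add: rescaled_def scaleC_blinfun.rep_eq)

lemma rescaled_of_real: "rescaled (of_real r) T t f = exp (- r * t) *\<^sub>R T t f"
proof -
  have "exp (- of_real r * complex_of_real t) = of_real (exp (- r * t))"
    by (simp add: exp_of_real[symmetric])
  thus ?thesis by (simp add: rescaled_apply scaleC_of_real)
qed

lemma C0_semigroup_rescaled:
  fixes T :: "real \<Rightarrow> 'a::complex_banach \<Rightarrow>\<^sub>L 'a"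
  assumes T: "C0_semigroup T"
  shows "C0_semigroup (rescaled c T)"
  unfolding C0_semigroup_def
proof (intro conjI allI impI)
  fix t s :: real and d :: complex and f :: 'a
  assume t: "0 \<le> t"
  show "rescaled c T t (d *\<^sub>C f) = d *\<^sub>C rescaled c T t f"
    using t by (simp add: rescaled_apply C0_semigroup_scaleC[OF T] scaleC_scaleC mult.commute)
next
  fix t s :: real assume st: "0 \<le> t" "0 \<le> s"
  show "rescaled c T (s + t) = rescaled c T s o\<^sub>L rescaled c T t"
  proof (rule blinfun_eqI)
    fix f
    have "exp (- c * of_real (s + t)) = exp (- c * of_real s) * exp (- c * of_real t)"
      by (simp add: exp_add[symmetric] algebra_simps)
    thus "rescaled c T (s + t) f = (rescaled c T s o\<^sub>L rescaled c T t) f"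
      using st by (simp add: rescaled_apply C0_semigroup_scaleC[OF T] C0_semigroup_add[OF T]
          scaleC_scaleC)
  qed
next
  show "rescaled c T 0 = id_blinfun"
    by (intro blinfun_eqI) (simp add: rescaled_apply scaleC_one C0_semigroup_0[OF T])
next
  fix f
  have "((\<lambda>t. exp (- c * of_real t) *\<^sub>C T t f) \<longlongrightarrow> exp (- c * of_real 0) *\<^sub>C f) (at_right 0)"
    by (intro scaleC.tendsto tendsto_intros C0_semigroup_tendsto[OF T])
  thus "((\<lambda>t. rescaled c T t f) \<longlongrightarrow> f) (at_right 0)" by (simp add: rescaled_apply scaleC_one)
qed

section \<open>The generator\<close>

lemma generator_eq_Some_iff:
  "generator T f = Some g \<longleftrightarrow> ((\<lambda>h. (T h f - f) /\<^sub>R h) \<longlongrightarrow> g) (at_right 0)"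
  unfolding generator_def
  by (auto simp: tendsto_Lim trivial_limit_at_right_real
      intro: tendsto_unique[OF trivial_limit_at_right_real])

lemma generator_linear:
  assumes "generator T f = Some g" "generator T f' = Some g'"
  shows "generator T (f + f') = Some (g + g')" "generator T (r *\<^sub>R f) = Some (r *\<^sub>R g)"
proof -
  have "((\<lambda>h. (T h f - f) /\<^sub>R h + (T h f' - f') /\<^sub>R h) \<longlongrightarrow> g + g') (at_right 0)"
    using assms unfolding generator_eq_Some_iff by (rule tendsto_add)
  thus "generator T (f + f') = Some (g + g')"
    unfolding generator_eq_Some_iff by (simp add: blinfun.add_right algebra_simps)
  have "((\<lambda>h. r *\<^sub>R ((T h f - f) /\<^sub>R h)) \<longlongrightarrow> r *\<^sub>R g) (at_right 0)"
    using assms(1) unfolding generator_eq_Some_iff by (intro tendsto_intros)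
  thus "generator T (r *\<^sub>R f) = Some (r *\<^sub>R g)"
    unfolding generator_eq_Some_iff by (simp add: blinfun.scaleR_right algebra_simps)
qed

lemma generator_scaleC:
  assumes T: "C0_semigroup T" and "generator T f = Some g"
  shows "generator T (c *\<^sub>C f) = Some (c *\<^sub>C g)"
proof -
  have "((\<lambda>h. c *\<^sub>C ((T h f - f) /\<^sub>R h)) \<longlongrightarrow> c *\<^sub>C g) (at_right 0)"
    using assms(2) unfolding generator_eq_Some_iff by (intro scaleC.tendsto tendsto_const)
  moreover have "eventually (\<lambda>h. c *\<^sub>C ((T h f - f) /\<^sub>R h) = (T h (c *\<^sub>C f) - c *\<^sub>C f) /\<^sub>R h) (at_right 0)"
    unfolding eventually_at_filter
    by (intro always_eventually) (simp add: C0_semigroup_scaleC[OF T] scaleC.diff_right scaleC.scaleR_right)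
  ultimately show ?thesis unfolding generator_eq_Some_iff by (rule Lim_transform_eventually)
qed

lemma generator_commute:
  assumes T: "C0_semigroup T" and "generator T f = Some g" and "0 \<le> t"
  shows "generator T (T t f) = Some (T t g)"
proof -
  have "((\<lambda>h. T t ((T h f - f) /\<^sub>R h)) \<longlongrightarrow> T t g) (at_right 0)"
    using assms(2) unfolding generator_eq_Some_iff by (intro tendsto_intros)
  moreover have "eventually (\<lambda>h. T t ((T h f - f) /\<^sub>R h) = (T h (T t f) - T t f) /\<^sub>R h) (at_right 0)"
    unfolding eventually_at_filter using assms(3)
    by (intro always_eventually)
      (simp add: blinfun.diff_right blinfun.scaleR_right C0_semigroup_commute[OF T])
  ultimately show ?thesis unfolding generator_eq_Some_iff by (rule Lim_transform_eventually)
qed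

lemma right_difference_quotient_tendsto:
  fixes F :: "real \<Rightarrow> 'a::real_normed_vector"
  assumes F: "(F has_vector_derivative D) (at x within {x..b})" and b: "x < b"
  shows "((\<lambda>h. (F (x + h) - F x) /\<^sub>R h) \<longlongrightarrow> D) (at_right 0)"
proof (rule tendstoI)
  fix e :: real assume e: "e > 0"
  have "\<forall>e>0. \<exists>d>0. \<forall>y\<in>{x..b}. norm (y - x) < d \<longrightarrow>
      norm (F y - F x - (y - x) *\<^sub>R D) \<le> e * norm (y - x)"
    using F unfolding has_vector_derivative_def has_derivative_within_alt by blast
  then obtain d where d: "d > 0"
    "\<And>y. y \<in> {x..b} \<Longrightarrow> norm (y - x) < d \<Longrightarrow> norm (F y - F x - (y - x) *\<^sub>R D) \<le> e / 2 * norm (y - x)"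
    using e by (meson half_gt_zero)
  have "dist ((F (x + h) - F x) /\<^sub>R h) D < e" if h: "0 < h" "h < min d (b - x)" for h
  proof -
    have "(F (x + h) - F x) /\<^sub>R h - D = (F (x + h) - F x - h *\<^sub>R D) /\<^sub>R h"
      using h by (simp add: scaleR_diff_right)
    moreover have "norm (F (x + h) - F x - h *\<^sub>R D) \<le> e / 2 * h"
      using d(2)[of "x + h"] h by simp
    hence "norm (F (x + h) - F x - h *\<^sub>R D) / h \<le> e / 2" using h by (simp add: divide_le_eq)
    moreover have "norm ((F (x + h) - F x - h *\<^sub>R D) /\<^sub>R h) = norm (F (x + h) - F x - h *\<^sub>R D) / h"
      using h by (simp only: norm_scaleR) (simp add: field_simps)
    ultimately have "norm ((F (x + h) - F x) /\<^sub>R h - D) \<le> e / 2" by (simp only:)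
    also have "\<dots> < e" using e by simp
    finally show ?thesis by (simp only: dist_norm)
  qed
  thus "eventually (\<lambda>h. dist ((F (x + h) - F x) /\<^sub>R h) D < e) (at_right 0)"
    unfolding eventually_at_right_field using d(1) b by (intro exI[of _ "min d (b - x)"]) auto
qed

lemma generator_rescaled:
  fixes T :: "real \<Rightarrow> 'a::complex_banach \<Rightarrow>\<^sub>L 'a"
  assumes T: "C0_semigroup T" and f: "generator T f = Some g"
  shows "generator (rescaled c T) f = Some (g - c *\<^sub>C f)"
proof -
  have "((\<lambda>h. exp (- c * of_real h)) has_vector_derivative - c) (at 0 within {0..1::real})"
  proof -
    have "((\<lambda>z. exp (- c * z)) has_field_derivative - c) (at (of_real 0))"
      by (auto intro!: derivative_eq_intros)
    thus ?thesis
      by (rule has_vector_derivative_real_field)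
  qed
  from right_difference_quotient_tendsto[OF this]
  have "((\<lambda>h. (exp (- c * of_real h) - 1) /\<^sub>R h) \<longlongrightarrow> - c) (at_right 0)" by simp
  hence "((\<lambda>h. exp (- c * of_real h) *\<^sub>C ((T h f - f) /\<^sub>R h) + ((exp (- c * of_real h) - 1) /\<^sub>R h) *\<^sub>C f)
      \<longlongrightarrow> exp (- c * of_real 0) *\<^sub>C g + (- c) *\<^sub>C f) (at_right 0)"
    using f unfolding generator_eq_Some_iff by (intro tendsto_intros scaleC.tendsto)
  moreover have "exp (- c * of_real h) *\<^sub>C ((T h f - f) /\<^sub>R h) + ((exp (- c * of_real h) - 1) /\<^sub>R h) *\<^sub>C f
      = (rescaled c T h f - f) /\<^sub>R h" for h
    by (simp add: rescaled_apply scaleC.diff_left scaleC.diff_right scaleC.scaleR_right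
        scaleC.scaleR_left scaleC_one scaleR_diff_right)
  ultimately show ?thesis
    unfolding generator_eq_Some_iff by (simp add: scaleC_one scaleC.minus_left)
qed

text \<open>
  The converse direction holds because rescaling by \<open>- c\<close> undoes rescaling by \<open>c\<close>.
\<close>

lemma generator_rescaled_iff:
  fixes T :: "real \<Rightarrow> 'a::complex_banach \<Rightarrow>\<^sub>L 'a"
  assumes T: "C0_semigroup T"
  shows "generator (rescaled c T) f = Some g \<longleftrightarrow> generator T f = Some (g + c *\<^sub>C f)"
proof
  assume "generator (rescaled c T) f = Some g"
  from generator_rescaled[OF C0_semigroup_rescaled[OF T] this, of "- c"]
  have "generator (rescaled (- c) (rescaled c T)) f = Some (g + c *\<^sub>C f)"
    by (simp add: scaleC.minus_left)
  moreover have "rescaled (- c) (rescaled c T) = T"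
    by (intro ext blinfun_eqI)
      (simp add: rescaled_apply scaleC_scaleC exp_add[symmetric] scaleC_one)
  ultimately show "generator T f = Some (g + c *\<^sub>C f)" by simp
qed (use generator_rescaled[OF T] in fastforce)

definition semigroup_integral ::
    "(real \<Rightarrow> 'a::complex_banach \<Rightarrow>\<^sub>L 'a) \<Rightarrow> real \<Rightarrow> 'a \<Rightarrow>\<^sub>L 'a" where
  "semigroup_integral T \<tau> = Blinfun (\<lambda>f. integral {0..\<tau>} (\<lambda>t. T t f))"

lemma semigroup_integrable:
  assumes T: "C0_semigroup T" and "0 \<le> a"
  shows "(\<lambda>t. T t f) integrable_on {a..b}"
  by (intro integrable_continuous_real continuous_on_subset[OF C0_semigroup_continuous_on[OF T]])
    (use assms in auto)

lemma has_integral_semigroup_integral: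
  fixes T :: "real \<Rightarrow> 'a::complex_banach \<Rightarrow>\<^sub>L 'a"
  assumes T: "C0_semigroup T"
  shows "((\<lambda>t. T t f) has_integral semigroup_integral T \<tau> f) {0..\<tau>}"
proof -
  obtain M where M: "M \<ge> 0" "\<And>t. t \<in> {0..\<tau>} \<Longrightarrow> norm (T t) \<le> M"
    using C0_semigroup_locally_bounded[OF T] by blast
  have int: "(\<lambda>t. T t f) integrable_on {0..\<tau>}" for f by (rule semigroup_integrable[OF T]) simp
  have "bounded_linear (\<lambda>f. integral {0..\<tau>} (\<lambda>t. T t f))"
  proof (rule bounded_linear_intro)
    fix f g :: 'a and r :: real
    show "integral {0..\<tau>} (\<lambda>t. T t (f + g)) = integral {0..\<tau>} (\<lambda>t. T t f) + integral {0..\<tau>} (\<lambda>t. T t g)"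
      by (simp add: blinfun.add_right integral_add int)
    show "integral {0..\<tau>} (\<lambda>t. T t (r *\<^sub>R f)) = r *\<^sub>R integral {0..\<tau>} (\<lambda>t. T t f)"
      by (simp add: blinfun.scaleR_right)
    show "norm (integral {0..\<tau>} (\<lambda>t. T t f)) \<le> norm f * (M * max 0 \<tau>)"
    proof (cases "0 \<le> \<tau>")
      case True
      have "norm (integral {0..\<tau>} (\<lambda>t. T t f)) \<le> (M * norm f) * (\<tau> - 0)"
        by (rule integral_bound[OF True continuous_on_subset[OF C0_semigroup_continuous_on[OF T]]])
          (auto intro!: order_trans[OF norm_blinfun] mult_right_mono M)
      thus ?thesis using True by (simp add: algebra_simps)
    qed (simp add: M)
  qed
  thus ?thesis
    using integrable_integral[OF int] by (simp add: semigroup_integral_def bounded_linear_Blinfun_apply)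
qed

lemma semigroup_semigroup_integral:
  assumes T: "C0_semigroup T" and h: "0 \<le> h"
  shows "T h (semigroup_integral T \<tau> f) = integral {h..\<tau> + h} (\<lambda>t. T t f)"
    and "T h (semigroup_integral T \<tau> f) = semigroup_integral T \<tau> (T h f)"
proof -
  have "((\<lambda>t. T h (T t f)) has_integral T h (semigroup_integral T \<tau> f)) {0..\<tau>}"
    using has_integral_linear[OF has_integral_semigroup_integral[OF T, of f \<tau>]
        blinfun.bounded_linear_right, of "T h"] by (simp add: o_def)
  hence 1: "((\<lambda>t. T (h + t) f) has_integral T h (semigroup_integral T \<tau> f)) {0..\<tau>}"
    by (rule has_integral_eq[rotated]) (simp add: C0_semigroup_add[OF T h])
  hence "((\<lambda>t. T t f) has_integral T h (semigroup_integral T \<tau> f)) {0 + h..\<tau> + h}"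
    using has_integral_shift_Icc_real[of "\<lambda>t. T t f" h _ 0 \<tau>] by (simp add: o_def)
  thus "T h (semigroup_integral T \<tau> f) = integral {h..\<tau> + h} (\<lambda>t. T t f)"
    by (simp add: integral_unique)
  from 1 have "((\<lambda>t. T t (T h f)) has_integral T h (semigroup_integral T \<tau> f)) {0..\<tau>}"
    by (rule has_integral_eq[rotated])
      (simp add: C0_semigroup_add[OF T h] C0_semigroup_commute[OF T h])
  with has_integral_semigroup_integral[OF T]
  show "T h (semigroup_integral T \<tau> f) = semigroup_integral T \<tau> (T h f)"
    by (meson has_integral_unique)
qed

text \<open>
  \<open>(T h - 1) \<integral>\<^sub>0\<^sup>\<tau> T t f dt\<close> telescopes to the integral of the orbit over \<open>[\<tau>, \<tau> + h]\<close> minus that over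
  \<open>[0, h]\<close>; dividing by \<open>h\<close> leaves the values of the orbit at \<open>\<tau>\<close> and \<open>0\<close>.
\<close>

lemma generator_semigroup_integral:
  assumes T: "C0_semigroup T" and \<tau>: "0 \<le> \<tau>"
  shows "generator T (semigroup_integral T \<tau> f) = Some (T \<tau> f - f)"
proof -
  define F where "F x = integral {0..x} (\<lambda>t. T t f)" for x
  have F: "semigroup_integral T x f = F x" for x
    using has_integral_semigroup_integral[OF T] F_def integral_unique by metis
  have deriv: "((\<lambda>h. (F (x + h) - F x) /\<^sub>R h) \<longlongrightarrow> T x f) (at_right 0)" if x: "0 \<le> x" for x
  proof -
    have "(F has_vector_derivative T x f) (at x within {0..x + 1})"
      unfolding F_def using x
      by (intro integral_has_vector_derivative continuous_on_subset[OF C0_semigroup_continuous_on[OF T]]) auto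
    hence "(F has_vector_derivative T x f) (at x within {x..x + 1})"
      using x by (elim has_vector_derivative_within_subset) auto
    thus ?thesis by (rule right_difference_quotient_tendsto) simp
  qed
  have "((\<lambda>h. (F (\<tau> + h) - F \<tau>) /\<^sub>R h - (F (0 + h) - F 0) /\<^sub>R h) \<longlongrightarrow> T \<tau> f - T 0 f) (at_right 0)"
    using \<tau> by (intro tendsto_diff deriv) auto
  moreover have "eventually (\<lambda>h. (F (\<tau> + h) - F \<tau>) /\<^sub>R h - (F (0 + h) - F 0) /\<^sub>R h =
      (T h (semigroup_integral T \<tau> f) - semigroup_integral T \<tau> f) /\<^sub>R h) (at_right 0)"
    unfolding eventually_at_filter
  proof (intro always_eventually allI impI)
    fix h :: real assume "h \<in> {0<..}"
    hence h: "0 \<le> h" by simp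
    have "F h + integral {h..\<tau> + h} (\<lambda>t. T t f) = F (\<tau> + h)"
      unfolding F_def using h \<tau> by (intro Henstock_Kurzweil_Integration.integral_combine
          semigroup_integrable[OF T]) auto
    hence "T h (semigroup_integral T \<tau> f) = F (\<tau> + h) - F h"
      unfolding semigroup_semigroup_integral(1)[OF T h] by (simp add: algebra_simps)
    moreover have "F 0 = 0" by (simp add: F_def)
    ultimately have "T h (semigroup_integral T \<tau> f) - semigroup_integral T \<tau> f =
        (F (\<tau> + h) - F \<tau>) - (F (0 + h) - F 0)"
      by (simp add: F)
    thus "(F (\<tau> + h) - F \<tau>) /\<^sub>R h - (F (0 + h) - F 0) /\<^sub>R h =
      (T h (semigroup_integral T \<tau> f) - semigroup_integral T \<tau> f) /\<^sub>R h"
      by (simp only: scaleR_diff_right)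
  qed
  ultimately show ?thesis
    unfolding generator_eq_Some_iff by (simp add: C0_semigroup_0[OF T] Lim_transform_eventually)
qed

text \<open>
  The bounded operator \<open>f \<mapsto> \<integral>\<^sub>0\<^sup>\<tau> T t f dt\<close> commutes with the difference quotients that define the
  generator, so this is the previous identity read on the domain.
\<close>

lemma semigroup_integral_generator:
  assumes T: "C0_semigroup T" and \<tau>: "0 \<le> \<tau>" and f: "generator T f = Some g"
  shows "semigroup_integral T \<tau> g = T \<tau> f - f"
proof -
  let ?S = "semigroup_integral T \<tau>"
  have "((\<lambda>h. ?S ((T h f - f) /\<^sub>R h)) \<longlongrightarrow> ?S g) (at_right 0)"
    using f unfolding generator_eq_Some_iff by (intro tendsto_intros)
  moreover have "eventually (\<lambda>h. ?S ((T h f - f) /\<^sub>R h) = (T h (?S f) - ?S f) /\<^sub>R h) (at_right 0)"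
    unfolding eventually_at_filter
    by (intro always_eventually)
      (simp add: blinfun.diff_right blinfun.scaleR_right semigroup_semigroup_integral(2)[OF T])
  ultimately have "generator T (?S f) = Some (?S g)"
    unfolding generator_eq_Some_iff by (rule Lim_transform_eventually)
  thus ?thesis using generator_semigroup_integral[OF T \<tau>, of f] by simp
qed

text \<open>
  For the rescaled semigroup the eigenvalue is \<open>0\<close>, and the integrated identity then says that the
  orbit is constant.
\<close>

lemma eigenvector_generator_semigroup:
  assumes T: "C0_semigroup T" and f: "generator T f = Some (c *\<^sub>C f)" and t: "0 \<le> t"
  shows "T t f = exp (c * of_real t) *\<^sub>C f"
proof -
  have "generator (rescaled c T) f = Some 0"
    using f by (simp add: generator_rescaled_iff[OF T])
  from semigroup_integral_generator[OF C0_semigroup_rescaled[OF T] t this]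
  have "rescaled c T t f = f" by (simp add: blinfun.zero_right)
  hence "exp (c * of_real t) *\<^sub>C rescaled c T t f = exp (c * of_real t) *\<^sub>C f" by simp
  thus ?thesis by (simp add: rescaled_apply scaleC_scaleC exp_add[symmetric] scaleC_one)
qed

section \<open>The resolvent\<close>

lemma resolvent_inverse:
  assumes "\<mu> \<in> resolvent_set A"
  shows "A (resolvent A \<mu> g) = Some (\<mu> *\<^sub>C resolvent A \<mu> g - g)"
    and "A v = Some w \<Longrightarrow> resolvent A \<mu> (\<mu> *\<^sub>C v - w) = v"
proof -
  let ?B = "\<lambda>f. \<mu> *\<^sub>C f - the (A f)"
  have bij: "bij_betw ?B (dom A) UNIV" and bl: "bounded_linear (inv_into (dom A) ?B)"
    using assms by (auto simp: resolvent_set_def)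
  have R: "blinfun_apply (resolvent A \<mu>) = inv_into (dom A) ?B"
    by (simp add: resolvent_def bounded_linear_Blinfun_apply[OF bl])
  have "g \<in> ?B ` dom A" using bij by (simp add: bij_betw_def)
  hence "resolvent A \<mu> g \<in> dom A" "?B (resolvent A \<mu> g) = g"
    unfolding R by (rule inv_into_into, rule f_inv_into_f)
  thus "A (resolvent A \<mu> g) = Some (\<mu> *\<^sub>C resolvent A \<mu> g - g)" by (auto simp: algebra_simps)
  show "resolvent A \<mu> (\<mu> *\<^sub>C v - w) = v" if v: "A v = Some w"
  proof -
    have "inv_into (dom A) ?B (?B v) = v"
      using bij v by (intro inv_into_f_f) (auto simp: bij_betw_def)
    thus ?thesis by (simp add: R v)
  qed
qed

lemma resolvent_eqI:
  assumes "\<mu> \<in> resolvent_set A" "A h = Some (\<mu> *\<^sub>C h - g)"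
  shows "h = resolvent A \<mu> g"
  using resolvent_inverse(2)[OF assms] by simp

lemma resolvent_scaleC:
  assumes "C0_semigroup T" "\<mu> \<in> resolvent_set (generator T)"
  shows "resolvent (generator T) \<mu> (c *\<^sub>C g) = c *\<^sub>C resolvent (generator T) \<mu> g"
  using generator_scaleC[OF assms(1) resolvent_inverse(1)[OF assms(2), of g], of c]
  by (intro resolvent_eqI[OF assms(2), symmetric])
    (simp add: scaleC.diff_right scaleC_scaleC mult.commute)

lemma resolvent_semigroup_commute:
  assumes "C0_semigroup T" "\<mu> \<in> resolvent_set (generator T)" "0 \<le> t"
  shows "resolvent (generator T) \<mu> (T t g) = T t (resolvent (generator T) \<mu> g)"
  using generator_commute[OF assms(1) resolvent_inverse(1)[OF assms(2), of g] assms(3)]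
  by (intro resolvent_eqI[OF assms(2), symmetric])
    (simp add: blinfun.diff_right C0_semigroup_scaleC[OF assms(1,3)])

lemma resolvent_identity:
  assumes "of_real x \<in> resolvent_set A" "of_real y \<in> resolvent_set A"
  shows "resolvent A (of_real y) g =
    resolvent A (of_real x) g + (x - y) *\<^sub>R resolvent A (of_real x) (resolvent A (of_real y) g)"
proof -
  let ?h = "resolvent A (of_real y) g"
  have "A ?h = Some (of_real x *\<^sub>C ?h - (g + (x - y) *\<^sub>R ?h))"
    using resolvent_inverse(1)[OF assms(2), of g] by (simp add: scaleC_of_real algebra_simps)
  from resolvent_eqI[OF assms(1) this] show ?thesis
    by (simp add: blinfun.add_right blinfun.scaleR_right)
qed

lemma norm_rescaled: "norm (rescaled c T t) = exp (- Re c * t) * norm (T t)"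
  by (simp add: rescaled_def norm_scaleC)

text \<open>
  The constant is chosen so that \<open>exp (- Re c) \<le> 1 / (\<parallel>T 1\<parallel> + 1)\<close>.
\<close>

lemma norm_rescaled_1_less_1:
  assumes "ln (norm (T 1) + 1) \<le> Re c"
  shows "norm (rescaled c T 1) < 1"
proof -
  have "exp (- Re c) \<le> exp (- ln (norm (T 1) + 1))" using assms by simp
  also have "\<dots> = inverse (norm (T 1) + 1)" by (simp add: exp_minus add_nonneg_pos)
  finally have "exp (- Re c) * norm (T 1) \<le> inverse (norm (T 1) + 1) * norm (T 1)"
    by (rule mult_right_mono) simp
  also have "\<dots> = norm (T 1) / (norm (T 1) + 1)" by (simp add: field_simps)
  also have "\<dots> < 1" by (subst divide_less_eq_1_pos) (simp_all add: add_nonneg_pos)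
  finally show ?thesis by (simp add: norm_rescaled)
qed

text \<open>
  For \<open>Re c\<close> large the operator \<open>rescaled c T 1\<close> is a contraction, and \<open>h = R(c, A) g\<close> is then the fixed
  point of an affine map built from the semigroup on \<open>[0, 1]\<close> alone.
\<close>

lemma rescaled_fixed_point:
  assumes T: "C0_semigroup T" and "generator T h = Some (c *\<^sub>C h - g)"
  shows "h = semigroup_integral (rescaled c T) 1 g + rescaled c T 1 h"
proof -
  have "generator (rescaled c T) h = Some (- g)"
    using assms(2) by (simp add: generator_rescaled_iff[OF T])
  from semigroup_integral_generator[OF C0_semigroup_rescaled[OF T] _ this, of 1]
  show ?thesis by (simp add: blinfun.minus_right algebra_simps)
qed

text \<open>
  The fixed point equation gives uniqueness and a norm bound for solutions of \<open>(c - A) h = g\<close>.  A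
  solution is \<open>S f\<close>, with \<open>S\<close> the integral of the rescaled semigroup over \<open>[0, 1]\<close> and \<open>f\<close> the fixed point of
  \<open>f \<mapsto> g + rescaled c T 1 f\<close>.
\<close>

lemma resolvent_set_if_rescaled_contraction:
  fixes T :: "real \<Rightarrow> 'a::complex_banach \<Rightarrow>\<^sub>L 'a"
  assumes T: "C0_semigroup T" and L: "norm (rescaled c T 1) < 1"
  shows "c \<in> resolvent_set (generator T)"
proof -
  define A where "A = generator T"
  define S where "S = semigroup_integral (rescaled c T) 1"
  let ?L = "rescaled c T 1"
  let ?B = "\<lambda>f. c *\<^sub>C f - the (A f)"
  have fix_pt: "h = S g + ?L h" if "A h = Some (c *\<^sub>C h - g)" for h g
    using rescaled_fixed_point[OF T] that by (simp add: A_def S_def)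
  have est: "(1 - norm ?L) * norm h \<le> norm S * norm g" if "A h = Some (c *\<^sub>C h - g)" for h g
  proof -
    have "norm h \<le> norm (S g) + norm (?L h)"
      using fix_pt[OF that] norm_triangle_ineq[of "S g" "?L h"] by simp
    also have "\<dots> \<le> norm S * norm g + norm ?L * norm h" by (intro add_mono norm_blinfun)
    finally show ?thesis by (simp add: algebra_simps)
  qed
  have lin: "A (v + r *\<^sub>R w) = Some (c *\<^sub>C (v + r *\<^sub>R w) - (f + r *\<^sub>R g))"
    if "A v = Some (c *\<^sub>C v - f)" "A w = Some (c *\<^sub>C w - g)" for v w f g r
    using generator_linear(1)[OF that(1)[unfolded A_def]
        generator_linear(2)[OF that(2)[unfolded A_def] that(2)[unfolded A_def], of r]]
    by (simp add: A_def algebra_simps scaleC.add_right scaleC.scaleR_right)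
  have uniq: "v = w" if "A v = Some (c *\<^sub>C v - g)" "A w = Some (c *\<^sub>C w - g)" for v w g
    using est[OF lin[OF that, of "-1"]] L by (simp add: mult_le_0_iff)
  have ex: "\<exists>h. A h = Some (c *\<^sub>C h - g)" for g
  proof -
    have "\<exists>!f. g + ?L f = f"
    proof (rule banach_fix_type[OF norm_ge_zero L], intro allI)
      fix x y
      show "dist (g + ?L x) (g + ?L y) \<le> norm ?L * dist x y"
        using norm_blinfun[of ?L "x - y"] by (simp add: dist_norm blinfun.diff_right)
    qed
    then obtain f where f: "g + ?L f = f" by blast
    have "generator (rescaled c T) (S f) = Some (?L f - f)"
      unfolding S_def by (rule generator_semigroup_integral[OF C0_semigroup_rescaled[OF T]]) simp
    moreover have "?L f - f = - g" using f by (simp add: algebra_simps eq_neg_iff_add_eq_0)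
    ultimately have "A (S f) = Some (c *\<^sub>C S f - g)"
      by (simp add: A_def generator_rescaled_iff[OF T])
    thus ?thesis by blast
  qed
  have inj: "inj_on ?B (dom A)"
  proof (rule inj_onI)
    fix v w assume "v \<in> dom A" "w \<in> dom A" and eq: "?B v = ?B w"
    hence "A v = Some (the (A v))" "A w = Some (the (A w))" by auto
    hence "A v = Some (c *\<^sub>C v - ?B v)" "A w = Some (c *\<^sub>C w - ?B w)" by simp_all
    from uniq[OF this(1) this(2)[folded eq]] show "v = w" .
  qed
  have surj: "?B ` dom A = UNIV"
  proof -
    have "g \<in> ?B ` dom A" for g
      using ex[of g] by (force simp: image_iff)
    thus ?thesis by blast
  qed
  define G where "G = inv_into (dom A) ?B"
  have G: "A (G g) = Some (c *\<^sub>C G g - g)" for g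
  proof -
    have "g \<in> ?B ` dom A" using surj by simp
    hence "G g \<in> dom A" "?B (G g) = g" unfolding G_def by (rule inv_into_into, rule f_inv_into_f)
    thus ?thesis by (auto simp: algebra_simps)
  qed
  have "bounded_linear G"
  proof (rule bounded_linear_intro)
    fix f g :: 'a and r :: real
    show "G (f + g) = G f + G g"
      using uniq[OF G[of "f + g"], of "G f + G g"] lin[OF G[of f] G[of g], of 1] by simp
    have "A 0 = Some (c *\<^sub>C 0 - 0)"
      using lin[OF G[of 0] G[of 0], of "-1"] by simp
    from lin[OF this G[of g], of r] show "G (r *\<^sub>R g) = r *\<^sub>R G g"
      by (intro uniq[OF G]) simp
    show "norm (G g) \<le> norm g * (norm S / (1 - norm ?L))"
      using est[OF G[of g]] L by (simp add: field_simps)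
  qed
  thus ?thesis
    using inj surj by (simp add: resolvent_set_def bij_betw_def G_def A_def)
qed

lemma spectral_bound_less_infinity:
  assumes T: "C0_semigroup T"
  shows "spectral_bound (generator T) < \<infinity>"
proof -
  have "Re \<mu> \<le> ln (norm (T 1) + 1)" if "\<mu> \<in> spectrum (generator T)" for \<mu>
    using that resolvent_set_if_rescaled_contraction[OF T norm_rescaled_1_less_1, of \<mu>]
    by (force simp: spectrum_def)
  hence "spectral_bound (generator T) \<le> ereal (ln (norm (T 1) + 1))"
    unfolding spectral_bound_def by (intro SUP_least) simp
  thus ?thesis by (rule order_le_less_trans) simp
qed

lemma in_resolvent_set_if_spectral_bound_less:
  assumes "spectral_bound A < ereal (Re \<mu>)"
  shows "\<mu> \<in> resolvent_set A"
proof (rule ccontr)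
  assume "\<mu> \<notin> resolvent_set A"
  hence "ereal (Re \<mu>) \<le> spectral_bound A"
    unfolding spectral_bound_def spectrum_def by (intro SUP_upper) simp
  thus False using assms by simp
qed

section \<open>Invariant cones\<close>

text \<open>
  Invariance of the cone passes from the semigroup to the resolvent on the whole half-line
  \<open>(s, \<infinity>)\<close>, although the Laplace integral of the semigroup is under control only far to the right.
  There the affine map of \<open>rescaled_fixed_point\<close> preserves \<open>C\<close>.  From a point \<open>x\<close> one moves left to a nearby
  \<open>z\<close> because \<open>R z g\<close> is the fixed point of \<open>h \<mapsto> R x g + (x - z) R x h\<close>, whose coefficients are nonnegative;
  the admissible step size is locally bounded below, so connectedness of the half-line gives all of it.
\<close>

lemma resolvent_invariant_cone:
  fixes T :: "real \<Rightarrow> 'a::complex_banach \<Rightarrow>\<^sub>L 'a"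
  assumes T: "C0_semigroup T"
    and C: "closed C" "0 \<in> C" "\<And>x y. x \<in> C \<Longrightarrow> y \<in> C \<Longrightarrow> x + y \<in> C"
      "\<And>r x. 0 \<le> r \<Longrightarrow> x \<in> C \<Longrightarrow> r *\<^sub>R x \<in> C"
    and inv: "\<And>t x. 0 \<le> t \<Longrightarrow> x \<in> C \<Longrightarrow> T t x \<in> C"
    and res: "\<And>y. s < y \<Longrightarrow> of_real y \<in> resolvent_set (generator T)"
    and y: "s < y" and f: "f \<in> C"
  shows "resolvent (generator T) (of_real y) f \<in> C"
proof -
  define R where "R y = resolvent (generator T) (of_real y)" for y
  \<comment> \<open>Stated for all \<open>y \<ge> x\<close>, so that moving \<open>x\<close> to the right is trivial and only steps to the
    left need an argument.\<close>
  define P where "P x \<longleftrightarrow> (\<forall>y\<ge>x. \<forall>g\<in>C. R y g \<in> C)" for x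
  define x0 where "x0 = max (s + 1) (ln (norm (T 1) + 1))"
  have ident: "R y g = R x g + ((x - y) *\<^sub>R R x) (R y g)" if "s < x" "s < y" for x y g
    using resolvent_identity[OF res[OF that(1)] res[OF that(2)]] by (simp add: R_def blinfun.scaleR_left)
  have "P x0"
    unfolding P_def
  proof (intro allI impI ballI)
    fix x g assume x: "x0 \<le> x" and g: "g \<in> C"
    let ?T = "rescaled (of_real x) T"
    have contr: "norm (?T 1) < 1" using x by (intro norm_rescaled_1_less_1) (simp add: x0_def)
    have inv': "?T t h \<in> C" if "0 \<le> t" "h \<in> C" for t h
      using that by (simp add: rescaled_of_real C inv)
    have int: "semigroup_integral ?T 1 g \<in> C"
      using has_integral_in_closed_convex_cone[OF C
          has_integral_semigroup_integral[OF C0_semigroup_rescaled[OF T]]] inv'[OF _ g] by simp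
    have "R x g = semigroup_integral ?T 1 g + ?T 1 (R x g)"
      unfolding R_def using x
      by (intro rescaled_fixed_point[OF T] resolvent_inverse(1) res) (simp add: x0_def)
    moreover have "semigroup_integral ?T 1 g + ?T 1 h \<in> C" if "h \<in> C" for h
      by (rule C(3)[OF int inv'[OF _ that]]) simp
    ultimately show "R x g \<in> C" using closed_fixed_point_iteration[OF C(1,2) _ _ contr] by metis
  qed
  have loc: "\<exists>V. openin (top_of_set {s<..}) V \<and> m \<in> V \<and> (\<forall>x\<in>V. \<forall>y\<in>V. P x \<longrightarrow> P y)" if m: "s < m" for m
  proof -
    define N where "N = norm (R m)"
    \<comment> \<open>Small enough that \<open>\<parallel>R x\<parallel> \<le> 2 N\<close> for \<open>x\<close> within \<open>\<eta>\<close> of \<open>m\<close>, and that a step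
      of length less than \<open>2 \<eta>\<close> from such an \<open>x\<close> is a contraction.\<close>
    define \<eta> where "\<eta> = 1 / (4 * (N + 1))"
    define V where "V = {s<..} \<inter> ball m \<eta>"
    have N0: "0 \<le> N" by (simp add: N_def)
    have \<eta>: "\<eta> > 0" "\<eta> * N \<le> 1 / 4" "\<eta> * N < 1 / 4"
      using N0 by (simp_all add: \<eta>_def field_simps)
    have bound: "norm (R x) \<le> 2 * N" if x: "x \<in> V" for x
    proof (rule norm_blinfun_bound)
      fix g
      have "\<bar>m - x\<bar> * N \<le> \<eta> * N" using x N0 by (intro mult_right_mono) (auto simp: V_def dist_real_def)
      hence small: "\<bar>m - x\<bar> * N \<le> 1 / 4" using \<eta> by simp
      have "norm (R x g) \<le> norm (R m g) + norm (((m - x) *\<^sub>R R m) (R x g))"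
        using ident[OF m, of x g] x norm_triangle_ineq[of "R m g" "((m - x) *\<^sub>R R m) (R x g)"]
        by (simp add: V_def)
      also have "norm (((m - x) *\<^sub>R R m) (R x g)) \<le> (\<bar>m - x\<bar> * N) * norm (R x g)"
        using norm_blinfun[of "(m - x) *\<^sub>R R m" "R x g"] by (simp add: N_def)
      also have "\<dots> \<le> 1 / 4 * norm (R x g)" by (rule mult_right_mono[OF small]) simp
      also have "norm (R m g) \<le> N * norm g" unfolding N_def by (rule norm_blinfun)
      finally show "norm (R x g) \<le> 2 * N * norm g"
        using mult_nonneg_nonneg[OF N0 norm_ge_zero[of g]] by simp
    qed (simp add: N0)
    have "P y" if x: "x \<in> V" and y: "y \<in> V" and P: "P x" for x y
      unfolding P_def
    proof (intro allI impI ballI)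
      fix z g assume z: "y \<le> z" and g: "g \<in> C"
      show "R z g \<in> C"
      proof (cases "x \<le> z")
        case True
        thus ?thesis using P g by (simp add: P_def)
      next
        case False
        have zV: "z \<in> V" using x y z False by (auto simp: V_def dist_real_def)
        have "norm ((x - z) *\<^sub>R R x) \<le> (2 * \<eta>) * (2 * N)"
          unfolding norm_scaleR using x zV bound[OF x] N0 \<eta>
          by (intro mult_mono) (auto simp: V_def dist_real_def)
        also have "\<dots> < 1" using \<eta> by (simp add: field_simps)
        finally have contr: "norm ((x - z) *\<^sub>R R x) < 1" .
        have inv': "R x g + ((x - z) *\<^sub>R R x) h \<in> C" if "h \<in> C" for h
        proof -
          have "R x g \<in> C" "R x h \<in> C" using P g that by (auto simp: P_def)
          moreover have "0 \<le> x - z" using False by simp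
          ultimately show ?thesis unfolding blinfun.scaleR_left by (intro C(3,4))
        qed
        have "R z g = R x g + ((x - z) *\<^sub>R R x) (R z g)"
          using x zV by (intro ident) (auto simp: V_def)
        from closed_fixed_point_iteration[OF C(1,2) inv' this contr] show ?thesis .
      qed
    qed
    moreover have "openin (top_of_set {s<..}) V" unfolding V_def by (rule openin_open_Int) simp
    moreover have "m \<in> V" using m \<eta>(1) by (simp add: V_def)
    ultimately show ?thesis by metis
  qed
  have "P y"
  proof (rule connected_induction_simple[of "{s<..}" x0])
    show "P x0" by fact
  qed (use y loc in \<open>simp_all add: x0_def\<close>)
  thus ?thesis using f by (simp add: P_def R_def)
qed

section \<open>Poles of vector-valued functions\<close>

text \<open>
  Convergence at one point of modulus \<open>3 r / 4\<close> bounds the terms there, which dominates the series on the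
  disc of radius \<open>r / 2\<close> by a geometric series with ratio \<open>2 / 3\<close>.
\<close>

lemma vector_power_series_uniform_limit:
  fixes U :: "nat \<Rightarrow> 'b::complex_banach"
  assumes r: "r > 0" and conv: "summable (\<lambda>n. (of_real (3 * r / 4) :: complex) ^ n *\<^sub>C U n)"
  shows "uniform_limit (cball 0 (r / 2)) (\<lambda>n w. \<Sum>i<n. w ^ i *\<^sub>C U i) (\<lambda>w. \<Sum>i. w ^ i *\<^sub>C U i) sequentially"
proof -
  have "Bseq (\<lambda>n. (of_real (3 * r / 4) :: complex) ^ n *\<^sub>C U n)"
    using summable_LIMSEQ_zero[OF conv] by (intro convergent_imp_Bseq convergentI)
  then obtain B where B: "\<And>n. norm ((of_real (3 * r / 4) :: complex) ^ n *\<^sub>C U n) \<le> B"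
    by (auto simp: Bseq_def)
  have B': "(3 * r / 4) ^ n * norm (U n) \<le> B" for n
    using B[of n] r by (simp add: norm_scaleC norm_power del: of_real_mult of_real_divide)
  show ?thesis
  proof (rule Weierstrass_m_test)
    fix n and w :: complex assume w: "w \<in> cball 0 (r / 2)"
    have "norm (w ^ n *\<^sub>C U n) = norm w ^ n * norm (U n)" by (simp add: norm_scaleC norm_power)
    also have "\<dots> \<le> (r / 2) ^ n * norm (U n)" using w by (intro mult_right_mono power_mono) auto
    also have "(r / 2) ^ n = (2 / 3) ^ n * (3 * r / 4) ^ n"
      by (simp add: power_mult_distrib[symmetric])
    also have "(2 / 3) ^ n * (3 * r / 4) ^ n * norm (U n) \<le> (2 / 3) ^ n * B"
      unfolding mult.assoc by (intro mult_left_mono B') simp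
    finally show "norm (w ^ n *\<^sub>C U n) \<le> (2 / 3) ^ n * B" .
  next
    show "summable (\<lambda>n. (2 / 3) ^ n * B :: real)" by (intro summable_mult2 summable_geometric) simp
  qed
qed

lemma laurent_sums_imp_power_series:
  fixes U :: "nat \<Rightarrow> 'b::complex_banach"
  assumes "(\<lambda>n. (z - z0) powi (int n - int k) *\<^sub>C U n) sums F z" and "z \<noteq> z0"
  shows "(\<lambda>n. (z - z0) ^ n *\<^sub>C U n) sums ((z - z0) ^ k *\<^sub>C F z)"
proof -
  have "(z - z0) ^ k *\<^sub>C (z - z0) powi (int n - int k) *\<^sub>C U n = (z - z0) ^ n *\<^sub>C U n" for n
  proof -
    have "(z - z0) ^ k * (z - z0) powi (int n - int k) = (z - z0) powi int n"
      using assms(2) by (simp add: power_int_diff)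
    thus ?thesis by (simp add: scaleC_scaleC)
  qed
  thus ?thesis
    using bounded_linear.sums[OF bounded_linear_scaleC assms(1), of "(z - z0) ^ k"] by simp
qed

text \<open>
  Multiplying by \<open>(z - z0)^k\<close> turns the Laurent series into a power series \<open>G\<close> that converges uniformly near
  \<open>z0\<close>.  Its continuity at \<open>z0\<close> identifies the leading coefficient as a limit.  For \<open>k = 1\<close> the normalised
  circle integral of \<open>F\<close> is the mean of \<open>G\<close> over the circle, which is \<open>G 0\<close> by termwise integration.
\<close>

lemma
  fixes U :: "nat \<Rightarrow> 'b::complex_banach" and F :: "complex \<Rightarrow> 'b"
  assumes r: "r > 0"
    and F: "\<And>z. z \<in> ball z0 r - {z0} \<Longrightarrow> (\<lambda>n. (z - z0) powi (int n - int k) *\<^sub>C U n) sums F z"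
  shows laurent_leading_coefficient: "((\<lambda>z. (z - z0) ^ k *\<^sub>C F z) \<longlongrightarrow> U 0) (at z0)"
    and simple_pole_circle_integral: "k = 1 \<Longrightarrow> \<forall>\<^sub>F \<rho> in at_right (0::real).
        ((\<lambda>\<theta>. (of_real (\<rho> / (2 * pi)) * cis \<theta>) *\<^sub>C F (z0 + of_real \<rho> * cis \<theta>))
           has_integral U 0) {0..2 * pi}"
proof -
  define G where "G w = (\<Sum>n. w ^ n *\<^sub>C U n)" for w
  have sums: "(\<lambda>n. w ^ n *\<^sub>C U n) sums (w ^ k *\<^sub>C F (z0 + w))" if "0 < norm w" "norm w < r" for w
    using that laurent_sums_imp_power_series[of "z0 + w" z0 k U F, OF F] by (auto simp: dist_norm)
  hence GF: "G w = w ^ k *\<^sub>C F (z0 + w)" if "0 < norm w" "norm w < r" for w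
    using that unfolding G_def by (metis sums_unique)
  have ul: "uniform_limit (cball 0 (r / 2)) (\<lambda>n w. \<Sum>i<n. w ^ i *\<^sub>C U i) G sequentially"
    unfolding G_def using r sums[of "of_real (3 * r / 4)"]
    by (intro vector_power_series_uniform_limit) (auto simp: sums_iff norm_mult norm_divide)
  have cont_partial: "continuous_on S (\<lambda>w. \<Sum>i<n. w ^ i *\<^sub>C U i)" for n S
    by (intro continuous_on_sum scaleC.continuous_on continuous_intros)
  show "((\<lambda>z. (z - z0) ^ k *\<^sub>C F z) \<longlongrightarrow> U 0) (at z0)"
  proof -
    have "continuous_on (cball 0 (r / 2)) G"
      by (rule uniform_limit_theorem[OF _ ul]) (auto intro!: always_eventually cont_partial)
    hence "continuous (at 0) G" using r by (intro continuous_on_interior) auto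
    moreover have "G 0 = U 0"
    proof -
      have "(\<lambda>n. 0 ^ n *\<^sub>C U n) sums (\<Sum>n\<in>{0}. 0 ^ n *\<^sub>C U n)"
        by (rule sums_finite) (auto simp: zero_power scaleC.zero_left)
      thus ?thesis by (simp add: G_def sums_iff scaleC_one)
    qed
    ultimately have "G \<midarrow>0\<rightarrow> U 0" by (simp add: continuous_at)
    moreover have "eventually (\<lambda>w. G w = (z0 + w - z0) ^ k *\<^sub>C F (z0 + w)) (at 0)"
      unfolding eventually_at using r by (intro exI[of _ r]) (auto simp: GF)
    ultimately have "(\<lambda>w. (z0 + w - z0) ^ k *\<^sub>C F (z0 + w)) \<midarrow>0\<rightarrow> U 0"
      by (rule Lim_transform_eventually)
    thus ?thesis by (rule LIM_offset_zero_cancel)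
  qed
  assume k: "k = 1"
  have "((\<lambda>\<theta>. (of_real (\<rho> / (2 * pi)) * cis \<theta>) *\<^sub>C F (z0 + of_real \<rho> * cis \<theta>))
           has_integral U 0) {0..2 * pi}" if \<rho>: "0 < \<rho>" "\<rho> < r / 2" for \<rho>
  proof -
    define w where "w \<theta> = of_real \<rho> * cis \<theta>" for \<theta>
    have w_norm: "norm (w \<theta>) = \<rho>" for \<theta> using \<rho> by (simp add: w_def norm_mult)
    have "uniform_limit {0..2 * pi} (\<lambda>n \<theta>. \<Sum>i<n. w \<theta> ^ i *\<^sub>C U i) (\<lambda>\<theta>. G (w \<theta>)) sequentially"
      by (rule uniform_limit_compose'[OF ul]) (use w_norm \<rho> in auto)
    moreover have "continuous_on {0..2 * pi} (\<lambda>\<theta>. \<Sum>i<n. w \<theta> ^ i *\<^sub>C U i)" for n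
      unfolding w_def by (intro continuous_on_sum scaleC.continuous_on continuous_intros)
    ultimately obtain I J where I: "\<And>n. ((\<lambda>\<theta>. \<Sum>i<n. w \<theta> ^ i *\<^sub>C U i) has_integral I n) {0..2 * pi}"
      and J: "((\<lambda>\<theta>. G (w \<theta>)) has_integral J) {0..2 * pi}" and IJ: "I \<longlonglongrightarrow> J"
      by (rule uniform_limit_integral) auto
    have coeff: "((\<lambda>\<theta>. w \<theta> ^ i *\<^sub>C U i) has_integral (if i = 0 then (2 * pi) *\<^sub>R U 0 else 0)) {0..2 * pi}" for i
    proof (cases "i = 0")
      case True
      thus ?thesis using has_integral_const_real[of "U 0" 0 "2 * pi"] by (simp add: scaleC_one)
    next
      case False
      define E where "E \<theta> = cis (real i * \<theta>) / (\<i> * of_nat i)" for \<theta>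
      have "((\<lambda>\<theta>. cis (real i * \<theta>)) has_integral (E (2 * pi) - E 0)) {0..2 * pi}"
      proof (rule fundamental_theorem_of_calculus)
        fix \<theta> :: real
        have "((\<lambda>z. exp (\<i> * of_nat i * z) / (\<i> * of_nat i)) has_field_derivative
            exp (\<i> * of_nat i * of_real \<theta>)) (at (of_real \<theta>))"
          using False by (auto intro!: derivative_eq_intros)
        from has_vector_derivative_real_field[OF this]
        show "(E has_vector_derivative cis (real i * \<theta>)) (at \<theta> within {0..2 * pi})"
          by (simp add: E_def[abs_def] cis_conv_exp mult.assoc)
      qed simp
      moreover have "E (2 * pi) - E 0 = 0"
        using cis_multiple_2pi[of "real i"] by (simp add: E_def mult.commute)
      ultimately have "((\<lambda>\<theta>. cis (real i * \<theta>)) has_integral 0) {0..2 * pi}" by simp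
      moreover have "bounded_linear (\<lambda>c. (of_real \<rho> ^ i * c) *\<^sub>C U i)"
        by (rule bounded_linear_compose[OF scaleC.bounded_linear_left bounded_linear_mult_right])
      ultimately have "((\<lambda>c. (of_real \<rho> ^ i * c) *\<^sub>C U i) \<circ> (\<lambda>\<theta>. cis (real i * \<theta>))
          has_integral (of_real \<rho> ^ i * 0) *\<^sub>C U i) {0..2 * pi}"
        by (rule has_integral_linear)
      hence "((\<lambda>\<theta>. (of_real \<rho> ^ i * cis (real i * \<theta>)) *\<^sub>C U i) has_integral 0) {0..2 * pi}"
        by (simp add: o_def scaleC.zero_left)
      moreover have "w \<theta> ^ i = of_real \<rho> ^ i * cis (real i * \<theta>)" for \<theta>
        by (simp add: w_def power_mult_distrib Complex.DeMoivre)
      ultimately show ?thesis using False by simp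
    qed
    have "I n = (\<Sum>i<n. if i = 0 then (2 * pi) *\<^sub>R U 0 else 0)" for n
      by (rule has_integral_unique[OF I]) (intro has_integral_sum coeff finite_lessThan)
    hence "I n = (2 * pi) *\<^sub>R U 0" if "n \<ge> 1" for n using that by (simp add: sum.delta)
    hence "eventually (\<lambda>n. I n = (2 * pi) *\<^sub>R U 0) sequentially"
      by (auto simp: eventually_sequentially)
    hence "I \<longlonglongrightarrow> (2 * pi) *\<^sub>R U 0" by (rule tendsto_eventually)
    hence "J = (2 * pi) *\<^sub>R U 0" using IJ LIMSEQ_unique by blast
    hence "((\<lambda>\<theta>. (1 / (2 * pi)) *\<^sub>R G (w \<theta>)) has_integral U 0) {0..2 * pi}"
      using has_integral_cmul[OF J, of "1 / (2 * pi)"] by simp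
    moreover have "(1 / (2 * pi)) *\<^sub>R G (w \<theta>) =
        (of_real (\<rho> / (2 * pi)) * cis \<theta>) *\<^sub>C F (z0 + of_real \<rho> * cis \<theta>)" for \<theta>
    proof -
      have "G (w \<theta>) = w \<theta> *\<^sub>C F (z0 + w \<theta>)" using GF[of "w \<theta>"] w_norm[of \<theta>] \<rho> r by (simp add: k)
      thus ?thesis by (simp add: scaleC_of_real[symmetric] scaleC_scaleC) (simp add: w_def)
    qed
    ultimately show ?thesis by simp
  qed
  thus "\<forall>\<^sub>F \<rho> in at_right (0::real).
        ((\<lambda>\<theta>. (of_real (\<rho> / (2 * pi)) * cis \<theta>) *\<^sub>C F (z0 + of_real \<rho> * cis \<theta>))
           has_integral U 0) {0..2 * pi}"
    unfolding eventually_at_right_field using r by (intro exI[of _ "r / 2"]) auto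
qed

section \<open>The leading coefficient of the resolvent at the spectral bound\<close>

text \<open>
  In this context \<open>Q\<close> is the coefficient of order \<open>- k\<close> in the Laurent expansion of the resolvent at \<open>s\<close>,
  described as a limit from the right.  Every property of \<open>Q\<close> is obtained by passing to that limit.
\<close>

context
  fixes T :: "real \<Rightarrow> 'a::complex_banach \<Rightarrow>\<^sub>L 'a" and s :: real and k :: nat and Q :: "'a \<Rightarrow>\<^sub>L 'a"
  assumes T: "C0_semigroup T"
    and res: "\<And>y. s < y \<Longrightarrow> of_real y \<in> resolvent_set (generator T)"
    and k: "0 < k"
    and Q: "((\<lambda>y. (y - s) ^ k *\<^sub>R resolvent (generator T) (of_real y)) \<longlongrightarrow> Q) (at_right s)"
begin

lemma leading_coefficient_tendsto:
  "((\<lambda>y. (y - s) ^ k *\<^sub>R resolvent (generator T) (of_real y) f) \<longlongrightarrow> Q f) (at_right s)"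
  using blinfun.tendsto[OF Q tendsto_const, of f] by (simp add: blinfun.scaleR_left)

lemma leading_coefficient_eqI:
  assumes "\<And>y. s < y \<Longrightarrow> (y - s) ^ k *\<^sub>R resolvent (generator T) (of_real y) f = h y"
    and "(h \<longlongrightarrow> g) (at_right s)"
  shows "Q f = g"
proof -
  have "eventually (\<lambda>y. h y = (y - s) ^ k *\<^sub>R resolvent (generator T) (of_real y) f) (at_right s)"
    using assms(1) by (auto simp: eventually_at_filter)
  hence "((\<lambda>y. (y - s) ^ k *\<^sub>R resolvent (generator T) (of_real y) f) \<longlongrightarrow> g) (at_right s)"
    by (rule Lim_transform_eventually[OF assms(2)])
  thus ?thesis
    by (rule tendsto_unique[OF trivial_limit_at_right_real leading_coefficient_tendsto])
qed

lemma leading_coefficient_scaleC: "Q (c *\<^sub>C f) = c *\<^sub>C Q f"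
proof (rule leading_coefficient_eqI)
  show "((\<lambda>y. c *\<^sub>C (y - s) ^ k *\<^sub>R resolvent (generator T) (of_real y) f) \<longlongrightarrow> c *\<^sub>C Q f) (at_right s)"
    by (intro scaleC.tendsto tendsto_const leading_coefficient_tendsto)
qed (simp add: resolvent_scaleC[OF T res] scaleC.scaleR_right)

lemma leading_coefficient_semigroup_commute: "0 \<le> t \<Longrightarrow> Q (T t f) = T t (Q f)"
proof (rule leading_coefficient_eqI)
  show "((\<lambda>y. T t ((y - s) ^ k *\<^sub>R resolvent (generator T) (of_real y) f)) \<longlongrightarrow> T t (Q f)) (at_right s)"
    by (intro tendsto_intros leading_coefficient_tendsto)
qed (simp add: resolvent_semigroup_commute[OF T res] blinfun.scaleR_right)

text \<open>
  The limit \<open>y \<rightarrow> s\<close> of the resolvent identity for \<open>x\<close> and \<open>y\<close>, multiplied by \<open>(y - s)^k\<close>: the summand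
  without \<open>R y\<close> vanishes since \<open>k > 0\<close>.
\<close>

lemma resolvent_leading_coefficient:
  assumes x: "s < x"
  shows "(x - s) *\<^sub>R resolvent (generator T) (of_real x) (Q f) = Q f"
proof -
  let ?R = "\<lambda>y. resolvent (generator T) (of_real y)"
  have "((\<lambda>y. (y - s) ^ k *\<^sub>R ?R x f + (x - y) *\<^sub>R ?R x ((y - s) ^ k *\<^sub>R ?R y f))
      \<longlongrightarrow> (s - s) ^ k *\<^sub>R ?R x f + (x - s) *\<^sub>R ?R x (Q f)) (at_right s)"
    by (intro tendsto_intros leading_coefficient_tendsto)
  hence lim: "((\<lambda>y. (y - s) ^ k *\<^sub>R ?R x f + (x - y) *\<^sub>R ?R x ((y - s) ^ k *\<^sub>R ?R y f))
      \<longlongrightarrow> (x - s) *\<^sub>R ?R x (Q f)) (at_right s)"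
    using k by (simp add: zero_power)
  have "(y - s) ^ k *\<^sub>R ?R y f =
      (y - s) ^ k *\<^sub>R ?R x f + (x - y) *\<^sub>R ?R x ((y - s) ^ k *\<^sub>R ?R y f)" if "s < y" for y
    by (subst resolvent_identity[OF res[OF x] res[OF that]])
      (simp add: blinfun.scaleR_right scaleR_add_right mult.commute)
  from leading_coefficient_eqI[OF this lim] show ?thesis by (rule sym)
qed

text \<open>
  The range of the leading coefficient consists of eigenvectors for the eigenvalue \<open>s\<close>.
\<close>

lemma generator_leading_coefficient: "generator T (Q f) = Some (s *\<^sub>R Q f)"
proof -
  let ?R = "resolvent (generator T) (of_real (s + 1))"
  have "?R (Q f) = Q f" using resolvent_leading_coefficient[of "s + 1" f] by simp
  moreover have "generator T (?R (Q f)) = Some (of_real (s + 1) *\<^sub>C ?R (Q f) - Q f)"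
    by (rule resolvent_inverse(1)[OF res]) simp
  ultimately have "generator T (Q f) = Some (of_real (s + 1) *\<^sub>C Q f - Q f)" by (simp only:)
  thus ?thesis by (simp only: scaleC_of_real scaleR_add_left) simp
qed

lemma semigroup_leading_coefficient:
  assumes "0 \<le> t"
  shows "T t (Q f) = exp (s * t) *\<^sub>R Q f"
proof -
  have "generator T (Q f) = Some (of_real s *\<^sub>C Q f)"
    unfolding scaleC_of_real by (rule generator_leading_coefficient)
  from eigenvector_generator_semigroup[OF T this assms]
  have "T t (Q f) = exp (of_real (s * t)) *\<^sub>C Q f" by (simp only: of_real_mult)
  thus ?thesis by (simp only: exp_of_real scaleC_of_real)
qed

text \<open>
  On the range of \<open>Q\<close> the resolvent is \<open>1 / (y - s)\<close>, so a factor \<open>(y - s)^(k - 1)\<close> remains.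
\<close>

lemma leading_coefficient_nilpotent:
  assumes "1 < k"
  shows "Q (Q f) = 0"
proof (rule leading_coefficient_eqI)
  have "((\<lambda>y. (y - s) ^ (k - 1) *\<^sub>R Q f) \<longlongrightarrow> (s - s) ^ (k - 1) *\<^sub>R Q f) (at_right s)"
    by (intro tendsto_intros)
  thus "((\<lambda>y. (y - s) ^ (k - 1) *\<^sub>R Q f) \<longlongrightarrow> 0) (at_right s)" using assms by (simp add: zero_power)
  fix y assume y: "s < y"
  let ?v = "resolvent (generator T) (of_real y) (Q f)"
  have "(y - s) ^ k *\<^sub>R ?v = ((y - s) ^ (k - 1) * (y - s)) *\<^sub>R ?v"
    using k by (simp only: power_minus_mult)
  also have "\<dots> = (y - s) ^ (k - 1) *\<^sub>R ((y - s) *\<^sub>R ?v)" by simp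
  finally show "(y - s) ^ k *\<^sub>R ?v = (y - s) ^ (k - 1) *\<^sub>R Q f"
    by (simp only: resolvent_leading_coefficient[OF y])
qed

lemma leading_coefficient_invariant_cone:
  assumes C: "closed C" "0 \<in> C" "\<And>x y. x \<in> C \<Longrightarrow> y \<in> C \<Longrightarrow> x + y \<in> C"
      "\<And>r x. 0 \<le> r \<Longrightarrow> x \<in> C \<Longrightarrow> r *\<^sub>R x \<in> C"
    and inv: "\<And>t x. 0 \<le> t \<Longrightarrow> x \<in> C \<Longrightarrow> T t x \<in> C" and f: "f \<in> C"
  shows "Q f \<in> C"
proof -
  have "eventually (\<lambda>y. (y - s) ^ k *\<^sub>R resolvent (generator T) (of_real y) f \<in> C) (at_right s)"
    unfolding eventually_at_filter
  proof (intro always_eventually allI impI)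
    fix y assume "y \<in> {s<..}"
    hence y: "s < y" by simp
    show "(y - s) ^ k *\<^sub>R resolvent (generator T) (of_real y) f \<in> C"
      using y by (intro C(4) resolvent_invariant_cone[OF T C inv res y f]) auto
  qed
  from Lim_in_closed_set[OF C(1) this _ leading_coefficient_tendsto]
  show ?thesis by simp
qed

end

section \<open>Eventual strong positivity\<close>

lemma closed_nonneg_complexification:
  "closed {z :: 'a::banach_lattice complexification. 0 \<le> z}"
proof -
  have re: "bounded_linear (re_part :: 'a complexification \<Rightarrow> 'a)"
    and im: "bounded_linear (im_part :: 'a complexification \<Rightarrow> 'a)"
    by (auto intro!: bounded_linear_intro[of _ 1] simp: norm_re_part_le norm_im_part_le)
  have "closed {x :: 'a. 0 \<le> x}"
    unfolding closed_sequential_limits mem_Collect_eq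
  proof (intro allI impI)
    fix X :: "nat \<Rightarrow> 'a" and l
    assume "(\<forall>n. 0 \<le> X n) \<and> X \<longlonglongrightarrow> l"
    thus "0 \<le> l" using banach_lattice_limit_nonneg[of X l] by simp
  qed
  hence "closed (re_part -` {x :: 'a. 0 \<le> x})"
    by (intro continuous_closed_vimage) (simp_all add: bounded_linear.isCont[OF re])
  moreover have "closed (im_part -` {0 :: 'a})"
    by (intro continuous_closed_vimage) (simp_all add: bounded_linear.isCont[OF im])
  moreover have "{z :: 'a complexification. 0 \<le> z} = re_part -` {x. 0 \<le> x} \<inter> im_part -` {0}"
    by (auto simp: less_eq_complexification_def)
  ultimately show ?thesis by (simp add: closed_Int)
qed

text \<open>
  Unlike the positive cone, this cone is invariant under the semigroup; under individual eventual
  positivity every orbit that starts in the positive cone enters it.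
\<close>

definition nonneg_orbits ::
    "(real \<Rightarrow> 'a::banach_lattice complexification \<Rightarrow>\<^sub>L 'a complexification) \<Rightarrow> 'a complexification set"
  where "nonneg_orbits T = {g. \<forall>t\<ge>0. 0 \<le> T t g}"

lemma nonneg_orbits_closed_convex_cone:
  shows "closed (nonneg_orbits T)" "0 \<in> nonneg_orbits T"
    "x \<in> nonneg_orbits T \<Longrightarrow> y \<in> nonneg_orbits T \<Longrightarrow> x + y \<in> nonneg_orbits T"
    "0 \<le> r \<Longrightarrow> x \<in> nonneg_orbits T \<Longrightarrow> r *\<^sub>R x \<in> nonneg_orbits T"
proof -
  have "nonneg_orbits T = (\<Inter>t\<in>{0..}. T t -` {z. 0 \<le> z})" by (auto simp: nonneg_orbits_def)
  moreover have "closed (T t -` {z. 0 \<le> z})" for t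
    by (intro continuous_closed_vimage closed_nonneg_complexification linear_continuous_at
        blinfun.bounded_linear_right)
  ultimately show "closed (nonneg_orbits T)" by (simp add: closed_INT)
qed (auto simp: nonneg_orbits_def blinfun.add_right blinfun.scaleR_right scaleR_nonneg_nonneg)

lemma nonneg_orbits_invariant:
  "C0_semigroup T \<Longrightarrow> 0 \<le> t \<Longrightarrow> g \<in> nonneg_orbits T \<Longrightarrow> T t g \<in> nonneg_orbits T"
  by (auto simp: nonneg_orbits_def C0_semigroup_add[symmetric])

text \<open>
  Positivity squeezes \<open>Q\<close> to zero on real elements dominated by a multiple of \<open>u\<close>, hence on the
  principal ideal, which is dense.
\<close>

lemma positive_operator_zero_at_quasi_interior:
  fixes Q :: "'a::banach_lattice complexification \<Rightarrow>\<^sub>L 'a complexification"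
  assumes u: "quasi_interior u" and pos: "\<And>f. 0 \<le> f \<Longrightarrow> 0 \<le> Q f"
    and lin: "\<And>c f. Q (c *\<^sub>C f) = c *\<^sub>C Q f" and zero: "Q u = 0"
  shows "Q = 0"
proof -
  have im_u: "im_part u = 0" using u by (simp add: quasi_interior_def less_eq_complexification_def)
  have dominated: "Q (Complexify x 0) = 0" if x: "\<bar>x\<bar> \<le> c *\<^sub>R re_part u" for x c
  proof -
    let ?x = "Complexify x 0"
    have "x \<le> c *\<^sub>R re_part u" "- x \<le> c *\<^sub>R re_part u" using x by (simp_all add: abs_le_iff)
    hence "0 \<le> c *\<^sub>R u - ?x" "0 \<le> c *\<^sub>R u + ?x"
      using im_u add_mono[of "- x" "c *\<^sub>R re_part u" x x]
      by (simp_all add: less_eq_complexification_def algebra_simps)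
    from this[THEN pos] have "0 \<le> - Q ?x" "0 \<le> Q ?x"
      by (simp_all add: blinfun.diff_right blinfun.add_right blinfun.scaleR_right zero)
    thus ?thesis by simp
  qed
  have ideal: "Q f = 0" if f: "f \<in> principal_ideal u" for f
  proof -
    obtain c where "modulus f \<le> c *\<^sub>R re_part u"
      using f by (auto simp: principal_ideal_def abs_complexification_def less_eq_complexification_def)
    hence dom: "\<bar>re_part f\<bar> \<le> c *\<^sub>R re_part u" "\<bar>im_part f\<bar> \<le> c *\<^sub>R re_part u"
      using abs_re_part_le_modulus[of f] abs_im_part_le_modulus[of f] by auto
    have "f = Complexify (re_part f) 0 + \<i> *\<^sub>C Complexify (im_part f) 0"
      by (simp add: complexification_eq_iff)
    hence "Q f = Q (Complexify (re_part f) 0) + \<i> *\<^sub>C Q (Complexify (im_part f) 0)"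
      by (metis blinfun.add_right lin)
    thus ?thesis by (simp only: dominated[OF dom(1)] dominated[OF dom(2)] scaleC.zero_right add_0)
  qed
  show ?thesis
  proof (rule blinfun_eqI)
    fix f
    have "closed (Q -` {0})"
      by (intro continuous_closed_vimage closed_singleton linear_continuous_at
          blinfun.bounded_linear_right)
    hence "closure (principal_ideal u) \<subseteq> Q -` {0}"
      using ideal by (intro closure_minimal) auto
    thus "Q f = (0 :: 'a complexification \<Rightarrow>\<^sub>L 'a complexification) f"
      using u by (auto simp: quasi_interior_def)
  qed
qed

text \<open>
  At a simple pole the spectral projection is the residue, since the circle integral equals the residue
  for all small radii.
\<close>

lemma spectral_projection_simple_pole:
  assumes "r > 0"
    and "\<And>z. z \<in> ball z0 r - {z0} \<Longrightarrow> (\<lambda>n. (z - z0) powi (int n - 1) *\<^sub>C U n) sums resolvent A z"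
  shows "spectral_projection A z0 = U 0"
proof -
  let ?I = "\<lambda>P \<rho>. ((\<lambda>\<theta>. (of_real (\<rho> / (2 * pi)) * cis \<theta>) *\<^sub>C resolvent A (z0 + of_real \<rho> * cis \<theta>))
           has_integral P) {0..2 * pi}"
  have U0: "eventually (?I (U 0)) (at_right 0)"
    using simple_pole_circle_integral[of r z0 1 U "resolvent A"] assms by simp
  show ?thesis
    unfolding spectral_projection_def
  proof (rule the_equality, rule U0)
    fix P assume "eventually (?I P) (at_right 0)"
    with U0 have "eventually (\<lambda>\<rho>. ?I (U 0) \<rho> \<and> ?I P \<rho>) (at_right (0::real))" by (rule eventually_conj)
    hence "\<exists>\<rho>. ?I (U 0) \<rho> \<and> ?I P \<rho>" by (rule eventually_happens'[rotated]) simp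
    thus "P = U 0" by (metis has_integral_unique)
  qed
qed

theorem theorem5p1:
  fixes T :: "real \<Rightarrow> 'a::banach_lattice complexification \<Rightarrow>\<^sub>L 'a complexification"
    and A :: "'a complexification \<rightharpoonup> 'a complexification"
    and u :: "'a complexification"
  assumes "C0_semigroup T"
    and "A = generator T"
    and "real_semigroup T"
    and "quasi_interior u"
    and "spectral_bound A \<noteq> -\<infinity>"
    and "pole_of_resolvent A (complex_of_real (real_of_ereal (spectral_bound A)))"
    and "individually_eventually_strongly_pos u T"
  shows "strongly_pos_op u
           (spectral_projection A (complex_of_real (real_of_ereal (spectral_bound A))))"
proof -
  note T = assms(1)
  obtain s where s: "spectral_bound A = ereal s"
    using spectral_bound_less_infinity[OF T] assms(2,5) by (cases "spectral_bound A") auto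
  obtain r k U where r: "r > 0" and k: "0 < k" and U0: "U (0::nat) \<noteq> 0"
    and laurent: "\<And>z. z \<in> ball (of_real s) r - {of_real s} \<Longrightarrow>
        (\<lambda>n. (z - of_real s) powi (int n - int k) *\<^sub>C U n) sums resolvent A z"
    using assms(6) unfolding pole_of_resolvent_def vector_pole_on_def s by auto
  define Q where "Q = U 0"
  have res: "of_real y \<in> resolvent_set (generator T)" if "s < y" for y
    using that s assms(2) by (intro in_resolvent_set_if_spectral_bound_less) simp
  have Q_lim: "((\<lambda>y. (y - s) ^ k *\<^sub>R resolvent (generator T) (of_real y)) \<longlongrightarrow> Q) (at_right s)"
  proof -
    have "((\<lambda>z. (z - of_real s) ^ k *\<^sub>C resolvent A z) \<longlongrightarrow> Q) (at (of_real s))"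
      unfolding Q_def by (rule laurent_leading_coefficient[OF r laurent])
    moreover have "filterlim of_real (at (of_real s :: complex)) (at_right s)"
      unfolding filterlim_at by (auto intro!: tendsto_intros simp: eventually_at_filter)
    ultimately have "((\<lambda>y. (of_real y - of_real s) ^ k *\<^sub>C resolvent A (of_real y)) \<longlongrightarrow> Q) (at_right s)"
      by (rule filterlim_compose)
    thus ?thesis
      by (simp only: assms(2) scaleC_of_real of_real_diff[symmetric] of_real_power[symmetric])
  qed
  note coeff = T res k Q_lim
  note Q_semigroup = semigroup_leading_coefficient[OF coeff]
  note Q_commute = leading_coefficient_semigroup_commute[OF coeff]
  have event: "\<exists>t\<ge>0. \<forall>\<tau>\<ge>t. strongly_pos u (T \<tau> f)" if "0 < f" for f
    using assms(7) that by (simp add: individually_eventually_strongly_pos_def)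
  \<comment> \<open>Once the orbit of \<open>f\<close> has entered the cone of nonnegative orbits, \<open>Q\<close> keeps it there,
    and on the range of \<open>Q\<close> the semigroup is a positive scalar.\<close>
  have Q_pos: "0 \<le> Q f" if f: "0 \<le> f" for f
  proof (cases "f = 0")
    case False
    hence "0 < f" using f by (simp add: less_complexification_def)
    then obtain t where t: "0 \<le> t" "\<And>\<tau>. t \<le> \<tau> \<Longrightarrow> 0 \<le> T \<tau> f"
      using event[of f] by (auto simp: strongly_pos_def)
    have orbit: "T t f \<in> nonneg_orbits T"
      using t by (simp add: nonneg_orbits_def C0_semigroup_add[OF T, symmetric])
    have "Q (T t f) \<in> nonneg_orbits T"
      by (rule leading_coefficient_invariant_cone[OF coeff])
        (simp_all add: orbit nonneg_orbits_closed_convex_cone nonneg_orbits_invariant[OF T])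
    hence "0 \<le> T 0 (Q (T t f))" by (simp add: nonneg_orbits_def)
    hence "0 \<le> exp (s * t) *\<^sub>R Q f"
      using t(1) by (simp add: C0_semigroup_0[OF T] Q_commute Q_semigroup)
    hence "0 \<le> exp (- s * t) *\<^sub>R exp (s * t) *\<^sub>R Q f" by (rule scaleR_nonneg_nonneg[rotated]) simp
    thus ?thesis by (simp add: exp_add[symmetric])
  qed (simp add: blinfun.zero_right)
  have Q_mono: "Q f \<le> Q g" if "f \<le> g" for f g
    using Q_pos[of "g - f"] that by (simp add: blinfun.diff_right)
  have u: "0 \<le> u" using assms(4) by (simp add: quasi_interior_def)
  have "Q u \<noteq> 0"
    using positive_operator_zero_at_quasi_interior[OF assms(4) Q_pos leading_coefficient_scaleC[OF coeff]] U0
    by (auto simp: Q_def)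
  hence "0 < Q u" using Q_pos[OF u] by (simp add: less_complexification_def)
  have scale: "\<exists>\<delta>>0. \<delta> *\<^sub>R v \<le> Q g" if "\<epsilon> *\<^sub>R v \<le> exp (s * t) *\<^sub>R Q g" "\<epsilon> > 0" for \<epsilon> t v g
  proof -
    have "exp (- s * t) *\<^sub>R \<epsilon> *\<^sub>R v \<le> exp (- s * t) *\<^sub>R exp (s * t) *\<^sub>R Q g"
      by (intro scaleR_left_mono that) simp
    hence "(exp (- s * t) * \<epsilon>) *\<^sub>R v \<le> Q g" by (simp add: exp_add[symmetric])
    thus ?thesis using that(2) by (intro exI[of _ "exp (- s * t) * \<epsilon>"]) simp
  qed
  \<comment> \<open>Apply eventual strong positivity to the positive eigenvector \<open>Q u\<close>.\<close>
  obtain \<delta> where \<delta>: "\<delta> > 0" "\<delta> *\<^sub>R u \<le> Q u"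
  proof -
    obtain t where "0 \<le> t" "strongly_pos u (T t (Q u))" using event[OF \<open>0 < Q u\<close>] by blast
    then obtain \<epsilon> where "\<epsilon> > 0" "\<epsilon> *\<^sub>R u \<le> exp (s * t) *\<^sub>R Q u"
      by (auto simp: strongly_pos_def Q_semigroup)
    from scale[OF this(2,1)] show ?thesis using that by metis
  qed
  \<comment> \<open>From \<open>T t f \<ge> \<epsilon> u\<close> and \<open>Q T t = e\<^bsup>s t\<^esup> Q\<close> it follows that \<open>Q f\<close> dominates a multiple of \<open>Q u\<close>,
    which dominates a multiple of \<open>u\<close>.\<close>
  have Q_lower: "\<exists>\<epsilon>>0. \<epsilon> *\<^sub>R u \<le> Q f" if f: "0 < f" for f
  proof -
    obtain t where t: "0 \<le> t" "strongly_pos u (T t f)" using event[OF f] by blast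
    then obtain \<epsilon> where \<epsilon>: "\<epsilon> > 0" "\<epsilon> *\<^sub>R u \<le> T t f" by (auto simp: strongly_pos_def)
    have "\<epsilon> *\<^sub>R Q u \<le> exp (s * t) *\<^sub>R Q f"
      using Q_mono[OF \<epsilon>(2)] t(1) by (simp add: blinfun.scaleR_right Q_commute Q_semigroup)
    then obtain \<eta> where \<eta>: "\<eta> > 0" "\<eta> *\<^sub>R Q u \<le> Q f" using scale \<epsilon>(1) by metis
    have "(\<eta> * \<delta>) *\<^sub>R u \<le> \<eta> *\<^sub>R Q u"
      using scaleR_left_mono[OF \<delta>(2), of \<eta>] \<eta>(1) by simp
    hence "(\<eta> * \<delta>) *\<^sub>R u \<le> Q f" using \<eta>(2) by (rule order_trans)
    thus ?thesis using \<eta>(1) \<delta>(1) by (intro exI[of _ "\<eta> * \<delta>"]) simp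
  qed
  \<comment> \<open>The square of \<open>Q\<close> is nonzero, because \<open>Q (Q u) \<ge> \<delta> Q u > 0\<close>.\<close>
  have "k = 1"
  proof (rule ccontr)
    assume "k \<noteq> 1"
    hence "Q (Q u) = 0" using k leading_coefficient_nilpotent[OF coeff] by simp
    moreover have "\<delta> *\<^sub>R Q u \<le> Q (Q u)" using Q_mono[OF \<delta>(2)] by (simp add: blinfun.scaleR_right)
    ultimately have "Q u \<le> 0"
      using \<delta>(1) scaleR_left_mono[of "\<delta> *\<^sub>R Q u" 0 "inverse \<delta>"] by simp
    thus False using \<open>0 < Q u\<close> by (simp add: less_le_not_le)
  qed
  hence "spectral_projection A (of_real s) = Q"
    unfolding Q_def using laurent by (intro spectral_projection_simple_pole[OF r]) simp
  thus ?thesis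
    using Q_lower Q_pos by (simp add: s strongly_pos_op_def strongly_pos_def less_complexification_def)
qed

end
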